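(* Let $f\in W^{2,1}(\mathbb{R})\cap C_b(\mathbb{R})$. Then for every $\sigma>0$, with $h=2\pi/\sigma$, $$|R_\sigma(f)|\le \frac{h^2}{12}\,\|f''\|_{L^1(\mathbb{R})}.$$
   Context: Fourier transform: $\widehat f(v)=\frac{1}{\sqrt{2\pi}}\int_{\mathbb{R}} f(u)e^{-iuv}\,du$ for $f\in L^1(\mathbb{R})$. $C_b(\mathbb{R})$ is the class of continuous bounded functions $f:\mathbb{R}\to\mathbb{C}$. For $r\in\mathbb{N}$, $W^{r,1}(\mathbb{R})$ is the set of $f\in L^1(\mathbb{R})$ such that $f=\phi$ a.e. for some $\phi$ which is $(r-1)$-times locally absolutely continuous (i.e. $\phi,\dots,\phi^{(r-1)}$ are locally absolutely continuous) with $\phi^{(k)}\in L^1(\mathbb{R})$ for $0\le k\le r$; one writes $f^{(k)}$ for $\phi^{(k)}$. Let $\mathcal{A}=\{f\in L^1(\mathbb{R})\cap C_b(\mathbb{R}) : f\in \mathrm{BV}(\mathbb{R})\text{ or }\widehat f\in \mathrm{BV}(\mathbb{R})\}$, where $\mathrm{BV}(\mathbb{R})$ is the set of functions of bounded variation over $\mathbb{R}$. One has $W^{1,1}(\mathbb{R})\cap C_b(\mathbb{R})\subset\mathcal{A}$. For $f\in\mathcal{A}$, $\sigma>0$ and $h=2\pi/\sigma$, $R_\sigma(f)$ denotes the remainder in the quadrature formula $\int_{-\infty}^\infty f(t)\,dt=h\sum_{k\in\mathbb{Z}}f(hk)+R_\sigma(f)$; by the Poisson summation formula, $R_\sigma(f)=-\sqrt{2\pi}\sum_{k\in\mathbb{Z}\setminus\{0\}}\widehat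 f(k\sigma)$. *)

theory Defs
  imports "HOL-Analysis.Analysis"
begin

definition L1_space :: "(real \<Rightarrow> complex) set" where
  "L1_space = {f. integrable lebesgue f}"

definition L1_norm :: "(real \<Rightarrow> complex) \<Rightarrow> real" where
  "L1_norm f = (LINT x|lebesgue. cmod (f x))"

text \<open>A finite family of non-overlapping subintervals is encoded as a finite set of pairs of
  endpoints. Degenerate pairs are harmless: they contribute nothing to either sum.\<close>

definition absolutely_continuous_on_Icc :: "real \<Rightarrow> real \<Rightarrow> (real \<Rightarrow> complex) \<Rightarrow> bool" where
  "absolutely_continuous_on_Icc a b f \<longleftrightarrow>
     (\<forall>\<epsilon>>0. \<exists>\<delta>>0. \<forall>P :: (real \<times> real) set.
        finite P \<and> (\<forall>(x, y)\<in>P. a \<le> x \<and> x \<le> y \<and> y \<le> b) \<and>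
        disjoint_family_on (\<lambda>(x, y). {x<..<y}) P \<and> (\<Sum>(x, y)\<in>P. y - x) < \<delta>
        \<longrightarrow> (\<Sum>(x, y)\<in>P. cmod (f y - f x)) < \<epsilon>)"

definition locally_absolutely_continuous :: "(real \<Rightarrow> complex) \<Rightarrow> bool" where
  "locally_absolutely_continuous f \<longleftrightarrow> (\<forall>a b. absolutely_continuous_on_Icc a b f)"

definition nth_deriv :: "nat \<Rightarrow> (real \<Rightarrow> complex) \<Rightarrow> real \<Rightarrow> complex" where
  "nth_deriv k = (\<lambda>g x. vector_derivative g (at x)) ^^ k"

text \<open>\<open>sobolev_rep r f \<phi>\<close>: \<open>\<phi>\<close> is an \<open>(r-1)\<close>-times locally absolutely continuous representative
  of \<open>f\<close>. Since \<open>vector_derivative\<close> is total, its value is arbitrary where the derivative does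
  not exist. This only concerns the top order: a locally absolutely continuous \<open>g\<close> is
  differentiable almost everywhere and the integral of its derivative, so if \<open>nth_deriv 1 g\<close> is
  continuous, then \<open>g\<close> is differentiable everywhere. Hence for \<open>k < r\<close> the function
  \<open>nth_deriv k \<phi>\<close> is a genuine derivative at every point, and for \<open>k = r\<close> at almost every point.\<close>

definition sobolev_rep :: "nat \<Rightarrow> (real \<Rightarrow> complex) \<Rightarrow> (real \<Rightarrow> complex) \<Rightarrow> bool" where
  "sobolev_rep r f \<phi> \<longleftrightarrow>
     (AE x in lebesgue. f x = \<phi> x) \<and>
     (\<forall>k<r. locally_absolutely_continuous (nth_deriv k \<phi>)) \<and>
     (\<forall>k\<le>r. nth_deriv k \<phi> \<in> L1_space)"

definition sobolev_W1 :: "nat \<Rightarrow> (real \<Rightarrow> complex) set" where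
  "sobolev_W1 r = {f \<in> L1_space. \<exists>\<phi>. sobolev_rep r f \<phi>}"

text \<open>The \<open>k\<close>-th derivative of \<open>f \<in> sobolev_W1 r\<close>. For \<open>r \<ge> 1\<close> the representative is continuous
  and hence unique.\<close>

definition sobolev_deriv :: "nat \<Rightarrow> nat \<Rightarrow> (real \<Rightarrow> complex) \<Rightarrow> real \<Rightarrow> complex" where
  "sobolev_deriv r k f = nth_deriv k (SOME \<phi>. sobolev_rep r f \<phi>)"

text \<open>Series over the integers are limits of symmetric partial sums, as in the Poisson summation
  formula; for absolutely convergent series this is the unordered sum. The limit is meaningful
  only under \<open>quadrature_convergent\<close>.\<close>

definition quadrature_sum :: "real \<Rightarrow> (real \<Rightarrow> complex) \<Rightarrow> nat \<Rightarrow> complex" where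
  "quadrature_sum h f N = of_real h * (\<Sum>k = - int N..int N. f (h * of_int k))"

definition quadrature_convergent :: "real \<Rightarrow> (real \<Rightarrow> complex) \<Rightarrow> bool" where
  "quadrature_convergent \<sigma> f \<longleftrightarrow> convergent (quadrature_sum (2 * pi / \<sigma>) f)"

definition quadrature_remainder :: "real \<Rightarrow> (real \<Rightarrow> complex) \<Rightarrow> complex" where
  "quadrature_remainder \<sigma> f = (LINT t|lebesgue. f t) - lim (quadrature_sum (2 * pi / \<sigma>) f)"

end

theory Submission
  imports Defs
begin

text \<open>By Lebesgue's theorem a locally absolutely continuous function is differentiable almost everywhere
  and is the integral of its derivative. Integrating \<open>w f''\<close> by parts over a cell \<open>[kh, (k+1)h]\<close> with
  \<open>w(t) = (t - kh) (t - (k+1)h) / 2 + h\<^sup>2 / 12\<close> gives the error of the trapezoidal rule on that cell plus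
  a multiple of the increment of \<open>f'\<close>, which telescopes. As \<open>f\<close> and \<open>f'\<close> are integrable with integrable
  derivative, they vanish at infinity, so summing over all cells yields \<open>R\<^sub>\<sigma>(f) = \<integral> K f''\<close>, where \<open>K\<close> is the
  \<open>h\<close>-periodic extension of \<open>w\<close>. The constant \<open>h\<^sup>2 / 12\<close> in \<open>w\<close> makes \<open>|K| \<le> h\<^sup>2 / 12\<close>; this bounds
  \<open>R\<^sub>\<sigma>(f)\<close> without using the Poisson summation formula.\<close>

section \<open>Differentiability of functions of bounded variation\<close>

text \<open>The obstacle is that \<open>f''\<close> is only the almost everywhere derivative of
  \<open>f'\<close>. The set where \<open>f'\<close> is not differentiable is null but may be
  uncountable, so the fundamental theorem with countably many exceptional points does not justify
  the integration by parts; absolute continuity has to absorb a null set. Gauge integrals suit this,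
  since tags in a null set can be given a gauge of their own.

  Any constant A in place of h^2 / 12 in \<open>w\<close> leads to the same remainder, because A
  only multiplies increments of \<open>f'\<close>. Since (t - kh) (t - (k+1)h) / 2 ranges over
  [- h^2 / 8, 0] on a cell, each A between h^2 / 24 and h^2 / 12 yields the bound; h^2 / 12 is the
  value that gives the kernel mean zero, as in the Euler-Maclaurin formula.

  The sums sample \<open>f\<close> at single points, whereas a Sobolev representative agrees with
  \<open>f\<close> only almost everywhere: the continuity of \<open>f\<close> closes this gap. The
  identity for the partial sums also proves that they converge, instead of presupposing it.\<close>

lemma lmeasurable_Un_negligible:
  assumes "T \<in> lmeasurable" "negligible N"
  shows "T \<union> N \<in> lmeasurable" "measure lebesgue (T \<union> N) = measure lebesgue T"
  using assms
  by (simp_all add: fmeasurable.Un negligible_imp_measurable measure_Un_null_set fmeasurableD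
      flip: negligible_iff_null_sets)

text \<open>Vitali's theorem selects a countable disjoint subfamily of \<open>K\<close> that covers
  almost all of \<open>S\<close>, and the bound on finite subfamilies passes to its union. A claim
  about null sets thus becomes an estimate for finite disjoint families, which a variation can
  control.\<close>

lemma Vitali_covering_intervals:
  fixes S :: "real set" and K :: "(real \<times> real) set"
  assumes K: "\<And>u v. (u, v) \<in> K \<Longrightarrow> u < v"
    and S: "\<And>x d. \<lbrakk>x \<in> S; 0 < d\<rbrakk> \<Longrightarrow> \<exists>(u, v)\<in>K. u \<le> x \<and> x \<le> v \<and> v - u < d"
    and D: "\<And>D. \<lbrakk>finite D; D \<subseteq> K; pairwise (\<lambda>(u, v) (u', v'). disjnt {u..v} {u'..v'}) D\<rbrakk>
              \<Longrightarrow> (\<Sum>(u, v)\<in>D. v - u) \<le> e"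
  shows "\<exists>T. S \<subseteq> T \<and> T \<in> lmeasurable \<and> measure lebesgue T \<le> e"
proof -
  define a where "a = (\<lambda>(u::real, v). (u + v) / 2)"
  define r where "r = (\<lambda>(u::real, v). (v - u) / 2)"
  have cb: "cball (a i) (r i) = {fst i..snd i}" for i
    by (auto simp: a_def r_def cball_eq_atLeastAtMost field_simps split: prod.splits)
  obtain C where C: "countable C" "C \<subseteq> K"
    "pairwise (\<lambda>i j. disjnt (cball (a i) (r i)) (cball (a j) (r j))) C"
    "negligible (S - (\<Union>i\<in>C. cball (a i) (r i)))"
  proof (rule Vitali_covering_theorem_cballs[of K r S a])
    show "0 < r i" if "i \<in> K" for i
      using K that by (cases i) (auto simp: r_def)
    show "\<exists>i. i \<in> K \<and> x \<in> cball (a i) (r i) \<and> r i < d" if x: "x \<in> S" "0 < d" for x d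
    proof -
      obtain u v where uv: "(u, v) \<in> K" "u \<le> x" "x \<le> v" "v - u < 2 * d"
        using S[of x "2 * d"] x by auto
      then show ?thesis
        unfolding cb by (intro exI[of _ "(u, v)"]) (auto simp: r_def)
    qed
  qed
  let ?T = "\<Union>i\<in>C. {fst i..snd i}"
  have bd: "measure lebesgue (\<Union>i\<in>D. {fst i..snd i}) \<le> e" if DC: "D \<subseteq> C" "finite D" for D
  proof -
    have "measure lebesgue (\<Union>i\<in>D. {fst i..snd i}) \<le> (\<Sum>i\<in>D. measure lebesgue {fst i..snd i})"
      by (rule measure_UNION_le) (use DC in auto)
    also have "\<dots> = (\<Sum>(u, v)\<in>D. v - u)"
      by (rule sum.cong) (use DC C K in \<open>force simp: less_imp_le\<close>)+
    also have "\<dots> \<le> e"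
    proof (rule D)
      show "pairwise (\<lambda>(u, v) (u', v'). disjnt {u..v} {u'..v'}) D"
        using pairwise_subset[OF C(3) DC(1)] unfolding cb by (simp add: pairwise_def case_prod_beta)
    qed (use DC C in auto)
    finally show ?thesis .
  qed
  have T: "?T \<in> lmeasurable"
    by (rule fmeasurable_UN_bound[OF C(1)]) (use bd in auto)
  have mT: "measure lebesgue ?T \<le> e"
    by (rule measure_UN_bound[OF C(1)]) (use bd in auto)
  let ?N = "S - ?T"
  have N: "negligible ?N" using C(4) unfolding cb .
  show ?thesis
  proof (intro exI[of _ "?T \<union> ?N"] conjI)
    show "?T \<union> ?N \<in> lmeasurable" "measure lebesgue (?T \<union> ?N) \<le> e"
      using lmeasurable_Un_negligible[OF T N] mT by simp_all
  qed auto
qed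

text \<open>Remove the interval with the largest left endpoint \<open>u\<close>: disjointness puts
  all the others to the left of \<open>u\<close>, so the induction applies with \<open>u\<close> in
  place of \<open>b\<close>.\<close>

lemma sum_increments_le:
  fixes H :: "real \<Rightarrow> real"
  assumes mono: "\<And>x y. \<lbrakk>a \<le> x; x \<le> y; y \<le> b\<rbrakk> \<Longrightarrow> H x \<le> H y" and "a \<le> b"
    and "finite D" "\<And>u v. (u, v) \<in> D \<Longrightarrow> a \<le> u \<and> u < v \<and> v \<le> b"
    and "pairwise (\<lambda>(u, v) (u', v'). disjnt {u..v} {u'..v'}) D"
  shows "(\<Sum>(u, v)\<in>D. H v - H u) \<le> H b - H a"
  using assms
proof (induction "card D" arbitrary: D b)
  case 0
  then show ?case by auto
next
  case (Suc n)
  have ne: "fst ` D \<noteq> {}" "finite (fst ` D)" using Suc by auto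
  obtain u v where uv: "(u, v) \<in> D" "u = Max (fst ` D)"
    using Max_in[OF ne(2,1)] by force
  define D' where "D' = D - {(u, v)}"
  have B: "a \<le> u" "u < v" "v \<le> b" using Suc.prems(4)[OF uv(1)] by auto
  have D': "a \<le> s \<and> s < t \<and> t \<le> u" if st: "(s, t) \<in> D'" for s t
  proof -
    have "(s, t) \<in> D" "(s, t) \<noteq> (u, v)" using st by (auto simp: D'_def)
    then have "s \<le> u" using Max_ge[OF ne(2), of s] uv(2) by force
    moreover have "s < t" "a \<le> s" using Suc.prems(4)[OF \<open>(s, t) \<in> D\<close>] by auto
    moreover have "disjnt {s..t} {u..v}"
      using pairwiseD[OF Suc.prems(5) \<open>(s, t) \<in> D\<close> uv(1) \<open>(s, t) \<noteq> (u, v)\<close>] by simp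
    ultimately show ?thesis using B unfolding disjnt_iff by (metis atLeastAtMost_iff less_imp_le not_le)
  qed
  have "(\<Sum>(s, t)\<in>D'. H t - H s) \<le> H u - H a"
  proof (rule Suc.hyps)
    show "n = card D'" using Suc uv by (simp add: D'_def)
    show "H x \<le> H y" if "a \<le> x" "x \<le> y" "y \<le> u" for x y
      using Suc.prems(1)[of x y] that B by auto
    show "pairwise (\<lambda>(u, v) (u', v'). disjnt {u..v} {u'..v'}) D'"
      using Suc.prems(5) by (rule pairwise_mono) (auto simp: D'_def)
  qed (use Suc.prems B D' in \<open>auto simp: D'_def\<close>)
  moreover have "(\<Sum>(s, t)\<in>D. H t - H s) = (H v - H u) + (\<Sum>(s, t)\<in>D'. H t - H s)"
    unfolding D'_def using uv(1) Suc.prems(3) by (subst sum.remove) auto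
  moreover have "H v \<le> H b" using Suc.prems(1)[of v b] B by auto
  ultimately show ?case by auto
qed

section \<open>Total variation as a function of the right endpoint\<close>

definition variation_sum :: "(real \<Rightarrow> real) \<Rightarrow> nat \<Rightarrow> (nat \<Rightarrow> real) \<Rightarrow> real" where
  "variation_sum G n p = (\<Sum>i<n. \<bar>G (p (Suc i)) - G (p i)\<bar>)"

text \<open>Monotone sequences on all naturals serve as partitions: repeated points add nothing to
  the variation sum, and a point is appended by redefining the sequence beyond
  \<open>n\<close>.\<close>

definition partition_upto :: "real \<Rightarrow> real \<Rightarrow> nat \<Rightarrow> (nat \<Rightarrow> real) \<Rightarrow> bool" where
  "partition_upto a x n p \<longleftrightarrow> mono p \<and> p 0 = a \<and> p n = x"

text \<open>A single bound serves all right endpoints \<open>x\<close>, so that the supremum in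
  \<open>variation\<close> is taken over a set bounded above for every \<open>x\<close> up to
  \<open>b\<close>.\<close>

definition variation_bounded :: "real \<Rightarrow> real \<Rightarrow> (real \<Rightarrow> real) \<Rightarrow> bool" where
  "variation_bounded a b G \<longleftrightarrow>
     (\<exists>B. \<forall>n p x. partition_upto a x n p \<and> x \<le> b \<longrightarrow> variation_sum G n p \<le> B)"

definition variation :: "real \<Rightarrow> (real \<Rightarrow> real) \<Rightarrow> real \<Rightarrow> real" where
  "variation a G x = Sup {variation_sum G n p | n p. partition_upto a x n p}"

lemma variation_upper:
  assumes "variation_bounded a b G" "partition_upto a x n p" "x \<le> b"
  shows "variation_sum G n p \<le> variation a G x"
proof -
  have "bdd_above {variation_sum G n p | n p. partition_upto a x n p}"
    using assms unfolding variation_bounded_def bdd_above_def by blast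
  then show ?thesis
    unfolding variation_def using assms(2) by (intro cSup_upper) auto
qed

lemma partition_upto_exists:
  assumes "a \<le> x" shows "partition_upto a x 1 (\<lambda>i. if i = 0 then a else x)"
  using assms by (auto simp: partition_upto_def intro!: monoI)

lemma variation_approx:
  assumes "variation_bounded a b G" "a \<le> x" "x \<le> b" "e > 0"
  obtains n p where "partition_upto a x n p" "variation a G x - e < variation_sum G n p"
proof -
  let ?A = "{variation_sum G n p | n p. partition_upto a x n p}"
  have "?A \<noteq> {}" using partition_upto_exists[OF assms(2)] by auto
  moreover have "bdd_above ?A"
    using assms unfolding variation_bounded_def bdd_above_def by blast
  ultimately have "\<exists>z\<in>?A. Sup ?A - e < z"
    using assms(4) by (subst less_cSup_iff[symmetric]) auto
  then show ?thesis using that by (auto simp: variation_def)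
qed

lemma variation_nonneg:
  assumes "variation_bounded a b G" "a \<le> x" "x \<le> b"
  shows "0 \<le> variation a G x"
  using variation_upper[OF assms(1) partition_upto_exists[OF assms(2)] assms(3)]
  by (simp add: variation_sum_def)

text \<open>Append \<open>y\<close> to a nearly optimal partition of \<open>[a, x]\<close>.\<close>

lemma variation_increment:
  assumes G: "variation_bounded a b G" and xy: "a \<le> x" "x \<le> y" "y \<le> b"
  shows "\<bar>G y - G x\<bar> \<le> variation a G y - variation a G x"
proof (rule field_le_epsilon)
  fix e :: real assume "e > 0"
  then obtain n p where p: "partition_upto a x n p" "variation a G x - e < variation_sum G n p"
    using variation_approx[OF G, of x e] xy by auto
  define q where "q = (\<lambda>i. if i \<le> n then p i else y)"
  have "p i \<le> y" if "i \<le> n" for i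
    using p(1) that xy unfolding partition_upto_def by (metis monoD order_trans)
  then have q: "partition_upto a y (Suc n) q"
    using p(1) by (auto simp: partition_upto_def q_def mono_def)
  have "variation_sum G (Suc n) q = variation_sum G n p + \<bar>G y - G x\<bar>"
    using p(1) by (simp add: variation_sum_def q_def partition_upto_def)
  then show "\<bar>G y - G x\<bar> \<le> variation a G y - variation a G x + e"
    using variation_upper[OF G q] xy p(2) by linarith
qed

section \<open>Exceptional sets of difference quotients\<close>

lemma frequently_slope_interval:
  fixes G :: "real \<Rightarrow> real"
  assumes "\<exists>\<^sub>F y in at x. P ((G y - G x) / (y - x))" and "0 < d"
  obtains u v where "u < v" "u \<le> x" "x \<le> v" "v - u < d" "P ((G v - G u) / (v - u))"
proof -
  obtain y where y: "y \<noteq> x" "dist y x < d" "P ((G y - G x) / (y - x))"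
    using assms by (auto simp: frequently_at)
  show ?thesis
  proof (cases "x < y")
    case True
    then show ?thesis using y that[of x y] by (auto simp: dist_real_def)
  next
    case False
    \<comment> \<open>The slope is symmetric in its two points, so a point to the left of
      \<open>x\<close> also yields an interval with endpoint \<open>x\<close>.\<close>
    moreover have "(G y - G x) / (y - x) = (G x - G y) / (x - y)"
      by (metis minus_diff_eq minus_divide_divide)
    ultimately show ?thesis using y that[of y x] by (auto simp: dist_real_def)
  qed
qed

text \<open>Austin's argument: take a partition whose variation sum is within \<open>c \<cdot> e\<close> of the total
  variation. In every cell pick small intervals whose slope has the sign opposite to the increment of
  \<open>G\<close> over the cell; each of them wastes at least \<open>c\<close> times its length of variation, so disjoint
  ones have total length at most \<open>e\<close>.\<close>

lemma negligible_oscillating_slope: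
  fixes G :: "real \<Rightarrow> real"
  assumes G: "variation_bounded a b G" and "c > 0"
  shows "negligible {x\<in>{a<..<b}. (\<exists>\<^sub>F y in at x. (G y - G x) / (y - x) < - c) \<and>
                                 (\<exists>\<^sub>F y in at x. c < (G y - G x) / (y - x))}" (is "negligible ?S")
proof (cases "a < b")
  case True
  define V where "V = variation a G"
  have V: "\<bar>G y - G x\<bar> \<le> V y - V x" if "a \<le> x" "x \<le> y" "y \<le> b" for x y
    using variation_increment[OF G that] by (simp add: V_def)
  have "\<exists>T. ?S \<subseteq> T \<and> T \<in> lmeasurable \<and> measure lebesgue T \<le> e" if e: "e > 0" for e
  proof -
    obtain n p where p: "partition_upto a b n p" "V b - c * e < variation_sum G n p"
      using variation_approx[OF G, of b "c * e"] True e \<open>c > 0\<close> unfolding V_def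
      by (metis less_imp_le mult_pos_pos order_refl)
    have pm: "mono p" "p 0 = a" "p n = b" using p(1) by (auto simp: partition_upto_def)
    have pab: "a \<le> p i" "p i \<le> b" if "i \<le> n" for i
      using pm that by (metis le0 monoD)+
    define good where "good = (\<lambda>i u v. p i \<le> u \<and> v \<le> p (Suc i) \<and>
       (if G (p i) \<le> G (p (Suc i)) then G v - G u < - c * (v - u) else c * (v - u) < G v - G u))"
    define K where "K = {(u, v). u < v \<and> (\<exists>i<n. good i u v)}"
    \<comment> \<open>Every interval of \<open>K\<close> is assigned one cell, so that a disjoint
      family can be summed cell by cell.\<close>
    have "\<exists>i<n. good i (fst k) (snd k)" if "k \<in> K" for k
      using that by (auto simp: K_def)
    then obtain idx where idx: "\<And>k. k \<in> K \<Longrightarrow> idx k < n \<and> good (idx k) (fst k) (snd k)"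
      by metis
    \<comment> \<open>Partition points are set aside, since a short interval containing one need not
      lie in a single cell. Being finitely many, they are added back to the cover
      afterwards.\<close>
    have "\<exists>T. ?S - p ` {..n} \<subseteq> T \<and> T \<in> lmeasurable \<and> measure lebesgue T \<le> e"
    proof (rule Vitali_covering_intervals[of K])
      show "u < v" if "(u, v) \<in> K" for u v using that by (auto simp: K_def)
    next
      fix x d :: real
      assume x: "x \<in> ?S - p ` {..n}" and "0 < d"
      then have "x < p n" "\<not> x < p 0" using pm by auto
      then obtain i where i: "i < n" "\<not> x < p i" "x < p (Suc i)"
        using ex_least_nat_less[of "\<lambda>j. x < p j" n] by auto
      have "x \<noteq> p i" using x i by auto
      then have d': "0 < min d (min (x - p i) (p (Suc i) - x))" using i \<open>0 < d\<close> by auto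
      show "\<exists>(u, v)\<in>K. u \<le> x \<and> x \<le> v \<and> v - u < d"
      proof (cases "G (p i) \<le> G (p (Suc i))")
        case True
        obtain u v where "u < v" "u \<le> x" "x \<le> v" "v - u < min d (min (x - p i) (p (Suc i) - x))"
          "(G v - G u) / (v - u) < - c"
          by (rule frequently_slope_interval[where P = "\<lambda>s. s < - c" and G = G and x = x, OF _ d']) (use x in auto)
        then have "u < v \<and> good i u v \<and> u \<le> x \<and> x \<le> v \<and> v - u < d"
          using True unfolding good_def by (auto simp: field_simps)
        then show ?thesis using i(1) unfolding K_def by blast
      next
        case False
        obtain u v where "u < v" "u \<le> x" "x \<le> v" "v - u < min d (min (x - p i) (p (Suc i) - x))"
          "c < (G v - G u) / (v - u)"
          by (rule frequently_slope_interval[where P = "\<lambda>s. c < s" and G = G and x = x, OF _ d']) (use x in auto)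
        then have "u < v \<and> good i u v \<and> u \<le> x \<and> x \<le> v \<and> v - u < d"
          using False unfolding good_def by (auto simp: field_simps)
        then show ?thesis using i(1) unfolding K_def by blast
      qed
    next
      fix D assume D: "finite D" "D \<subseteq> K" "pairwise (\<lambda>(u, v) (u', v'). disjnt {u..v} {u'..v'}) D"
      have part: "(\<Sum>(u, v)\<in>{k\<in>D. idx k = i}. c * (v - u))
          \<le> (V (p (Suc i)) - V (p i)) - \<bar>G (p (Suc i)) - G (p i)\<bar>" if i: "i < n" for i
      proof -
        define s where "s = (if G (p i) \<le> G (p (Suc i)) then 1 else - 1 :: real)"
        \<comment> \<open>\<open>H\<close> is monotone because \<open>V\<close> dominates the
          increments of \<open>G\<close>. On a good interval \<open>s * G\<close> falls by more than
          \<open>c * (v - u)\<close>, so \<open>H\<close> rises by at least that; over the whole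
          cell \<open>H\<close> rises exactly by the wasted variation.\<close>
        define H where "H = (\<lambda>x. V x - s * G x)"
        have pi: "a \<le> p i" "p i \<le> p (Suc i)" "p (Suc i) \<le> b"
          using pab[of i] pab[of "Suc i"] i incseq_SucD[OF pm(1), of i] by auto
        have mem: "u < v \<and> good i u v" if "(u, v) \<in> {k\<in>D. idx k = i}" for u v
        proof -
          have "(u, v) \<in> K" "idx (u, v) = i" using that D(2) by auto
          then show ?thesis using idx[of "(u, v)"] by (auto simp: K_def)
        qed
        have "(\<Sum>(u, v)\<in>{k\<in>D. idx k = i}. c * (v - u)) \<le> (\<Sum>(u, v)\<in>{k\<in>D. idx k = i}. H v - H u)"
        proof (rule sum_mono, safe)
          fix u v assume uv: "(u, v) \<in> D" "i = idx (u, v)"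
          then have m: "u < v" "good i u v" using mem by auto
          then have "\<bar>G v - G u\<bar> \<le> V v - V u" using V[of u v] pi by (auto simp: good_def)
          then show "c * (v - u) \<le> H v - H u"
            using m(2) by (auto simp: good_def H_def s_def algebra_simps split: if_splits)
        qed
        also have "\<dots> \<le> H (p (Suc i)) - H (p i)"
        proof (rule sum_increments_le)
          show "H x \<le> H y" if "p i \<le> x" "x \<le> y" "y \<le> p (Suc i)" for x y
            using V[of x y] that pi by (auto simp: H_def s_def)
          show "p i \<le> u \<and> u < v \<and> v \<le> p (Suc i)" if "(u, v) \<in> {k\<in>D. idx k = i}" for u v
            using mem[OF that] by (auto simp: good_def)
          show "pairwise (\<lambda>(u, v) (u', v'). disjnt {u..v} {u'..v'}) {k\<in>D. idx k = i}"
            by (rule pairwise_subset[OF D(3)]) auto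
        qed (use D pi in auto)
        also have "\<dots> = (V (p (Suc i)) - V (p i)) - \<bar>G (p (Suc i)) - G (p i)\<bar>"
          by (auto simp: H_def s_def)
        finally show ?thesis .
      qed
      have "c * (\<Sum>(u, v)\<in>D. v - u) = (\<Sum>(u, v)\<in>D. c * (v - u))"
        by (simp add: sum_distrib_left case_prod_beta)
      also have "\<dots> = (\<Sum>i<n. \<Sum>(u, v)\<in>{k\<in>D. idx k = i}. c * (v - u))"
        using D(1,2) idx by (subst sum.group) auto
      also have "\<dots> \<le> (\<Sum>i<n. (V (p (Suc i)) - V (p i)) - \<bar>G (p (Suc i)) - G (p i)\<bar>)"
        by (intro sum_mono part) auto
      also have "\<dots> = V b - V a - variation_sum G n p"
        using sum_lessThan_telescope[of "\<lambda>i. V (p i)" n] by (simp add: sum_subtractf pm variation_sum_def)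
      also have "\<dots> \<le> c * e"
        using p(2) variation_nonneg[OF G, of a] True by (simp add: V_def)
      finally show "(\<Sum>(u, v)\<in>D. v - u) \<le> e"
        using \<open>c > 0\<close> by simp
    qed
    then obtain T where T: "?S - p ` {..n} \<subseteq> T" "T \<in> lmeasurable" "measure lebesgue T \<le> e" by blast
    have N: "negligible (p ` {..n})" by (simp add: negligible_finite)
    show ?thesis
    proof (intro exI[of _ "T \<union> p ` {..n}"] conjI)
      show "?S \<subseteq> T \<union> p ` {..n}" using T(1) by blast
      show "T \<union> p ` {..n} \<in> lmeasurable" "measure lebesgue (T \<union> p ` {..n}) \<le> e"
        using lmeasurable_Un_negligible[OF T(2) N] T(3) by simp_all
    qed
  qed
  then show ?thesis unfolding negligible_outer_le by blast
qed (auto simp: greaterThanLessThan_empty_iff)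

text \<open>An interval with slope above \<open>M\<close> in absolute value consumes more than
  \<open>M\<close> times its length of variation, so disjoint ones have total length at most
  \<open>(V b - V a) / M\<close>.\<close>

lemma negligible_unbounded_slope:
  fixes G :: "real \<Rightarrow> real"
  assumes G: "variation_bounded a b G"
  shows "negligible {x\<in>{a<..<b}. \<forall>M. \<exists>\<^sub>F y in at x. M < \<bar>(G y - G x) / (y - x)\<bar>}"
    (is "negligible ?S")
proof (cases "a < b")
  case True
  define V where "V = variation a G"
  have V: "\<bar>G y - G x\<bar> \<le> V y - V x" if "a \<le> x" "x \<le> y" "y \<le> b" for x y
    using variation_increment[OF G that] by (simp add: V_def)
  have "\<exists>T. ?S \<subseteq> T \<and> T \<in> lmeasurable \<and> measure lebesgue T \<le> e" if e: "e > 0" for e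
  proof -
    \<comment> \<open>The \<open>+ 1\<close> keeps \<open>M\<close> positive when the variation is
      zero.\<close>
    define M where "M = (V b - V a + 1) / e"
    have "M > 0" using V[of a b] True that by (simp add: M_def)
    define K where "K = {(u, v). a \<le> u \<and> u < v \<and> v \<le> b \<and> M * (v - u) < \<bar>G v - G u\<bar>}"
    show ?thesis
    proof (rule Vitali_covering_intervals[of K])
      show "u < v" if "(u, v) \<in> K" for u v using that by (auto simp: K_def)
    next
      fix x d :: real
      assume x: "x \<in> ?S" and "0 < d"
      then have d': "0 < min d (min (x - a) (b - x))" by auto
      obtain u v where "u < v" "u \<le> x" "x \<le> v" "v - u < min d (min (x - a) (b - x))"
        "M < \<bar>(G v - G u) / (v - u)\<bar>"
        by (rule frequently_slope_interval[where P = "\<lambda>s. M < \<bar>s\<bar>" and G = G and x = x, OF _ d']) (use x in auto)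
      then have "(u, v) \<in> K \<and> u \<le> x \<and> x \<le> v \<and> v - u < d"
        by (auto simp: K_def abs_divide field_simps)
      then show "\<exists>(u, v)\<in>K. u \<le> x \<and> x \<le> v \<and> v - u < d" by blast
    next
      fix D assume D: "finite D" "D \<subseteq> K" "pairwise (\<lambda>(u, v) (u', v'). disjnt {u..v} {u'..v'}) D"
      have "M * (\<Sum>(u, v)\<in>D. v - u) = (\<Sum>(u, v)\<in>D. M * (v - u))"
        by (simp add: sum_distrib_left case_prod_beta)
      also have "\<dots> \<le> (\<Sum>(u, v)\<in>D. V v - V u)"
      proof (rule sum_mono, safe)
        fix u v assume "(u, v) \<in> D"
        then have "a \<le> u" "u < v" "v \<le> b" "M * (v - u) < \<bar>G v - G u\<bar>"
          using D(2) by (auto simp: K_def)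
        then show "M * (v - u) \<le> V v - V u" using V[of u v] by auto
      qed
      also have "\<dots> \<le> V b - V a"
      proof (rule sum_increments_le[OF _ _ D(1) _ D(3)])
        show "V x \<le> V y" if "a \<le> x" "x \<le> y" "y \<le> b" for x y
          using V[OF that] by auto
      qed (use True D(2) in \<open>auto simp: K_def\<close>)
      also have "\<dots> \<le> M * e" using that by (simp add: M_def)
      finally show "(\<Sum>(u, v)\<in>D. v - u) \<le> e" using \<open>M > 0\<close> by simp
    qed
  qed
  then show ?thesis unfolding negligible_outer_le by blast
qed (auto simp: greaterThanLessThan_empty_iff)

text \<open>Subtracting a line of slope \<open>m\<close> shifts every difference quotient by
  \<open>- m\<close>, which serves to centre a gap between two slopes at zero. It costs at most
  \<open>\<bar>m\<bar> * (b - a)\<close> in variation.\<close>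

lemma variation_bounded_tilt:
  assumes "variation_bounded a b G"
  shows "variation_bounded a b (\<lambda>x. G x - m * x)"
proof -
  obtain B where B: "\<And>n p x. partition_upto a x n p \<Longrightarrow> x \<le> b \<Longrightarrow> variation_sum G n p \<le> B"
    using assms unfolding variation_bounded_def by blast
  have "variation_sum (\<lambda>x. G x - m * x) n p \<le> B + \<bar>m\<bar> * (b - a)"
    if p: "partition_upto a x n p" "x \<le> b" for n p x
  proof -
    have "variation_sum (\<lambda>x. G x - m * x) n p
        \<le> (\<Sum>i<n. \<bar>G (p (Suc i)) - G (p i)\<bar> + \<bar>m\<bar> * (p (Suc i) - p i))"
      unfolding variation_sum_def
    proof (rule sum_mono)
      fix i
      have "\<bar>p (Suc i) - p i\<bar> = p (Suc i) - p i"
        using p by (simp add: partition_upto_def monoD)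
      then have "\<bar>m\<bar> * (p (Suc i) - p i) = \<bar>m * (p (Suc i) - p i)\<bar>"
        by (simp add: abs_mult)
      then show "\<bar>G (p (Suc i)) - m * p (Suc i) - (G (p i) - m * p i)\<bar>
          \<le> \<bar>G (p (Suc i)) - G (p i)\<bar> + \<bar>m\<bar> * (p (Suc i) - p i)"
        by (simp add: right_diff_distrib)
    qed
    also have "\<dots> = variation_sum G n p + \<bar>m\<bar> * (x - a)"
      using p by (simp add: variation_sum_def sum.distrib sum_lessThan_telescope
          partition_upto_def flip: sum_distrib_left)
    also have "\<dots> \<le> B + \<bar>m\<bar> * (b - a)"
      using B[OF p] p(2) by (intro add_mono mult_left_mono) auto
    finally show ?thesis .
  qed
  then show ?thesis unfolding variation_bounded_def by blast
qed

text \<open>The lower and upper limits are finite by the bound. If they agree, they are the limit;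
  if not, two rationals fit strictly between them. Rational gaps are used because there are only
  countably many of them.\<close>

lemma bounded_imp_tendsto_or_oscillates:
  fixes q :: "'a \<Rightarrow> real"
  assumes "F \<noteq> bot" and bd: "\<forall>\<^sub>F y in F. \<bar>q y\<bar> \<le> M"
  shows "(\<exists>l. (q \<longlongrightarrow> l) F) \<or>
         (\<exists>r1\<in>\<rat>. \<exists>r2\<in>\<rat>. r1 < r2 \<and> (\<exists>\<^sub>F y in F. q y < r1) \<and> (\<exists>\<^sub>F y in F. r2 < q y))"
proof -
  define L where "L = Liminf F (\<lambda>y. ereal (q y))"
  define U where "U = Limsup F (\<lambda>y. ereal (q y))"
  have LU: "L \<le> U" unfolding L_def U_def by (rule Liminf_le_Limsup[OF assms(1)])
  have L: "ereal (- M) \<le> L" unfolding L_def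
    by (rule Liminf_bounded) (use bd in eventually_elim, auto)
  have U: "U \<le> ereal M" unfolding U_def
    by (rule Limsup_bounded) (use bd in eventually_elim, auto)
  show ?thesis
  proof (cases "L = U")
    case True
    then obtain l where l: "L = ereal l" using L U by (cases L) auto
    have "((\<lambda>y. ereal (q y)) \<longlongrightarrow> ereal l) F"
      using True l by (intro Liminf_eq_Limsup) (auto simp: assms(1) L_def U_def)
    then show ?thesis by auto
  next
    case False
    then have "L < U" using LU by auto
    then obtain p1 where p1: "L < ereal p1" "ereal p1 < U" using ereal_dense2 by blast
    then obtain p2 where p2: "ereal p1 < ereal p2" "ereal p2 < U" using ereal_dense2 by blast
    obtain r1 where r1: "r1 \<in> \<rat>" "p1 < r1" "r1 < p2" using Rats_dense_in_real[of p1 p2] p2 by auto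
    obtain r2 where r2: "r2 \<in> \<rat>" "r1 < r2" "r2 < p2" using Rats_dense_in_real[of r1 p2] r1 by auto
    have "\<exists>\<^sub>F y in F. q y < r1"
    proof (rule ccontr)
      assume "\<not> ?thesis"
      then have "\<forall>\<^sub>F y in F. ereal r1 \<le> ereal (q y)" by (simp add: frequently_def not_less)
      then have "ereal r1 \<le> L" unfolding L_def by (rule Liminf_bounded)
      then show False using p1(1) r1(2) by (meson ereal_less_eq(3) less_imp_le not_le order_trans)
    qed
    moreover have "\<exists>\<^sub>F y in F. r2 < q y"
    proof (rule ccontr)
      assume "\<not> ?thesis"
      then have "\<forall>\<^sub>F y in F. ereal (q y) \<le> ereal r2" by (simp add: frequently_def not_less)
      then have "U \<le> ereal r2" unfolding U_def by (rule Limsup_bounded)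
      then show False using p2(2) r2(3) by (meson ereal_less_eq(3) less_imp_le not_le order_trans)
    qed
    ultimately show ?thesis using r1 r2 by blast
  qed
qed

text \<open>At a point without derivative the difference quotients are either unbounded or lie
  frequently on both sides of some rational gap. Both alternatives describe null sets.\<close>

lemma variation_bounded_differentiable_AE:
  fixes G :: "real \<Rightarrow> real"
  assumes G: "variation_bounded a b G"
  shows "negligible {x\<in>{a<..<b}. \<not> (\<exists>l. (G has_real_derivative l) (at x))}" (is "negligible ?S")
proof -
  define osc where "osc = (\<lambda>H c. {x\<in>{a<..<b}. (\<exists>\<^sub>F y in at x. (H y - H x) / (y - x) < - c) \<and>
                                 (\<exists>\<^sub>F y in at x. c < (H y - H x) / (y - x))})"
  \<comment> \<open>Tilting by the midpoint slope makes the gap symmetric about zero, with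
    \<open>c\<close> equal to half its width.\<close>
  define N where "N = (\<lambda>(r1::real, r2).
     if r1 < r2 then osc (\<lambda>x. G x - (r1 + r2) / 2 * x) ((r2 - r1) / 2) else {})"
  define N0 where "N0 = {x\<in>{a<..<b}. \<forall>M. \<exists>\<^sub>F y in at x. M < \<bar>(G y - G x) / (y - x)\<bar>}"
  have "negligible (osc H c)" if "variation_bounded a b H" "c > 0" for H c
    unfolding osc_def by (rule negligible_oscillating_slope[OF that])
  then have "negligible (N r)" for r
    unfolding N_def using variation_bounded_tilt[OF G, of "(fst r + snd r) / 2"] by (simp add: case_prod_beta)
  then have "negligible (N0 \<union> (\<Union>r\<in>\<rat> \<times> \<rat>. N r))"
    using negligible_unbounded_slope[OF G]
    unfolding N0_def
    by (intro negligible_Un negligible_countable_Union countable_image countable_SIGMA countable_rat) auto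
  moreover have "?S \<subseteq> N0 \<union> (\<Union>r\<in>\<rat> \<times> \<rat>. N r)"
  proof
    fix x assume x: "x \<in> ?S"
    let ?q = "\<lambda>y. (G y - G x) / (y - x)"
    show "x \<in> N0 \<union> (\<Union>r\<in>\<rat> \<times> \<rat>. N r)"
    proof (cases "x \<in> N0")
      case False
      then obtain M where M: "\<forall>\<^sub>F y in at x. \<bar>?q y\<bar> \<le> M"
        using x by (auto simp: N0_def frequently_def not_less)
      have "\<not> (\<exists>l. (?q \<longlongrightarrow> l) (at x))"
        using x by (simp add: has_field_derivative_iff)
      then obtain r1 r2 where r: "r1 \<in> \<rat>" "r2 \<in> \<rat>" "r1 < r2"
        "\<exists>\<^sub>F y in at x. ?q y < r1" "\<exists>\<^sub>F y in at x. r2 < ?q y"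
        using bounded_imp_tendsto_or_oscillates[OF _ M] by auto
      define m where "m = (r1 + r2) / 2"
      have slope: "((G y - m * y) - (G x - m * x)) / (y - x) = ?q y - m" if "y \<noteq> x" for y
        using that by (simp add: field_simps)
      have ne: "\<forall>\<^sub>F y in at x. y \<noteq> x" by (simp add: eventually_at_filter)
      have 1: "\<exists>\<^sub>F y in at x. ((G y - m * y) - (G x - m * x)) / (y - x) < - ((r2 - r1) / 2)"
      proof (rule frequently_mp[OF _ r(4)], use ne in eventually_elim, intro impI)
        fix y assume "y \<noteq> x" "?q y < r1"
        then show "((G y - m * y) - (G x - m * x)) / (y - x) < - ((r2 - r1) / 2)"
          unfolding slope[OF \<open>y \<noteq> x\<close>] by (simp add: m_def diff_divide_distrib add_divide_distrib)
      qed
      have 2: "\<exists>\<^sub>F y in at x. (r2 - r1) / 2 < ((G y - m * y) - (G x - m * x)) / (y - x)"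
      proof (rule frequently_mp[OF _ r(5)], use ne in eventually_elim, intro impI)
        fix y assume "y \<noteq> x" "r2 < ?q y"
        then show "(r2 - r1) / 2 < ((G y - m * y) - (G x - m * x)) / (y - x)"
          unfolding slope[OF \<open>y \<noteq> x\<close>] by (simp add: m_def diff_divide_distrib add_divide_distrib)
      qed
      have "x \<in> N (r1, r2)"
        using x r(3) 1 2 by (simp add: N_def osc_def m_def)
      then show ?thesis using r by blast
    qed simp
  qed
  ultimately show ?thesis by (rule negligible_subset)
qed

section \<open>Absolutely continuous functions\<close>

lemma absolutely_continuous_on_IccE:
  assumes "absolutely_continuous_on_Icc a b F" "e > 0"
  obtains \<delta> where "\<delta> > 0" "\<And>P. \<lbrakk>finite P; \<forall>(x, y)\<in>P. a \<le> x \<and> x \<le> y \<and> y \<le> b;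
        disjoint_family_on (\<lambda>(x, y). {x<..<y}) P; (\<Sum>(x, y)\<in>P. y - x) < \<delta>\<rbrakk>
        \<Longrightarrow> (\<Sum>(x, y)\<in>P. cmod (F y - F x)) < e"
  using assms(1)[unfolded absolutely_continuous_on_Icc_def, THEN spec, THEN mp, OF assms(2)]
proof (elim exE conjE)
  fix \<delta> :: real
  assume \<delta>: "\<delta> > 0" and ac: "\<forall>P. finite P \<and> (\<forall>(x, y)\<in>P. a \<le> x \<and> x \<le> y \<and> y \<le> b) \<and>
        disjoint_family_on (\<lambda>(x, y). {x<..<y}) P \<and> (\<Sum>(x, y)\<in>P. y - x) < \<delta>
        \<longrightarrow> (\<Sum>(x, y)\<in>P. cmod (F y - F x)) < e"
  show thesis
    by (rule that[OF \<delta>], rule ac[THEN spec, THEN mp]) (intro conjI)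
qed

text \<open>Take the \<delta> belonging to 1: a partition of an interval shorter than \<delta> has
  total length below \<delta>, hence variation sum at most 1. Short intervals suffice for a local
  property. \<open>G\<close> is meant to be the real or the imaginary part of
  \<open>F\<close>.\<close>

lemma absolutely_continuous_variation_bounded:
  assumes F: "absolutely_continuous_on_Icc a b F"
    and G: "\<And>x y. \<bar>G y - G x\<bar> \<le> cmod (F y - F x)"
  obtains \<delta> where "\<delta> > 0" "\<And>u v. \<lbrakk>a \<le> u; v \<le> b; v - u < \<delta>\<rbrakk> \<Longrightarrow> variation_bounded u v G"
proof -
  obtain \<delta> where \<delta>: "\<delta> > 0" and ac: "\<And>P. \<lbrakk>finite P; \<forall>(x, y)\<in>P. a \<le> x \<and> x \<le> y \<and> y \<le> b;
        disjoint_family_on (\<lambda>(x, y). {x<..<y}) P; (\<Sum>(x, y)\<in>P. y - x) < \<delta>\<rbrakk>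
        \<Longrightarrow> (\<Sum>(x, y)\<in>P. cmod (F y - F x)) < 1"
    by (rule absolutely_continuous_on_IccE[OF F zero_less_one that])
  have "variation_sum G n p \<le> 1"
    if uv: "a \<le> u" "v \<le> b" "v - u < \<delta>" and p: "partition_upto u x n p" "x \<le> v" for u v n p x
  proof -
    have pm: "mono p" "p 0 = u" "p n = x" using p by (auto simp: partition_upto_def)
    have pS: "p i \<le> p (Suc i)" for i using pm(1) by (rule incseq_SucD)
    \<comment> \<open>Absolute continuity speaks of sets of pairs, so a sum over cells must be a sum
      over an injective image. Dropping the degenerate cells makes \<open>Q\<close> injective and
      leaves the variation sum unchanged.\<close>
    define I where "I = {i. i < n \<and> p i < p (Suc i)}"
    have I: "finite I" "I \<subseteq> {..<n}" by (auto simp: I_def)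
    have eq: "p (Suc i) = p i" if "i \<in> {..<n} - I" for i
      using that pS[of i] by (auto simp: I_def)
    have sep: "p (Suc i) \<le> p j" if "i < j" for i j
      using that pm(1) by (simp add: Suc_leI monoD)
    define Q where "Q = (\<lambda>i. (p i, p (Suc i)))"
    have inj: "inj_on Q I"
    proof (rule linorder_inj_onI)
      fix i j assume "i < j" "i \<in> I" "j \<in> I"
      then show "Q i \<noteq> Q j" using sep[of i j] by (auto simp: Q_def I_def)
    qed auto
    have "(\<Sum>(x, y)\<in>Q ` I. cmod (F y - F x)) < 1"
    proof (rule ac)
      show "\<forall>(x, y)\<in>Q ` I. a \<le> x \<and> x \<le> y \<and> y \<le> b"
      proof (clarsimp simp: Q_def)
        fix i assume "i \<in> I"
        then have "p 0 \<le> p i" "p (Suc i) \<le> p n"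
          using monoD[OF pm(1), of 0 i] monoD[OF pm(1), of "Suc i" n] by (auto simp: I_def)
        then show "a \<le> p i \<and> p i \<le> p (Suc i) \<and> p (Suc i) \<le> b"
          using pS[of i] pm uv p(2) by auto
      qed
      show "disjoint_family_on (\<lambda>(x, y). {x<..<y}) (Q ` I)"
        unfolding disjoint_family_on_def
      proof (intro ballI impI)
        fix s t assume "s \<in> Q ` I" "t \<in> Q ` I" "s \<noteq> t"
        then obtain i j where st: "s = Q i" "t = Q j" "i \<noteq> j" by auto
        then have "i < j \<or> j < i" by auto
        then show "(case s of (x, y) \<Rightarrow> {x<..<y}) \<inter> (case t of (x, y) \<Rightarrow> {x<..<y}) = {}"
          using sep[of i j] sep[of j i] by (auto simp: st Q_def)
      qed
      have "(\<Sum>(x, y)\<in>Q ` I. y - x) = (\<Sum>i\<in>I. p (Suc i) - p i)"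
        by (subst sum.reindex[OF inj]) (simp add: Q_def)
      also have "\<dots> \<le> (\<Sum>i<n. p (Suc i) - p i)"
        using I pS by (intro sum_mono2) auto
      also have "\<dots> = x - u" using pm by (simp add: sum_lessThan_telescope)
      finally show "(\<Sum>(x, y)\<in>Q ` I. y - x) < \<delta>" using uv p(2) by linarith
    qed (use I in auto)
    then have "(\<Sum>i\<in>I. cmod (F (p (Suc i)) - F (p i))) < 1"
      by (subst (asm) sum.reindex[OF inj]) (simp add: Q_def)
    moreover have "variation_sum G n p = (\<Sum>i\<in>I. \<bar>G (p (Suc i)) - G (p i)\<bar>)"
      unfolding variation_sum_def using I eq by (intro sum.mono_neutral_right) auto
    moreover have "\<dots> \<le> (\<Sum>i\<in>I. cmod (F (p (Suc i)) - F (p i)))"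
      by (intro sum_mono G)
    ultimately show ?thesis by linarith
  qed
  then show ?thesis
    using that[OF \<delta>] unfolding variation_bounded_def by blast
qed

text \<open>Negligibility is a local property, so it is enough to treat intervals short enough for
  the real and imaginary parts to have bounded variation.\<close>

lemma locally_absolutely_continuous_differentiable_AE:
  assumes F: "locally_absolutely_continuous F"
  shows "negligible {x. \<not> (\<exists>l. (F has_vector_derivative l) (at x))}" (is "negligible ?S")
proof (subst locally_negligible_alt, rule ballI)
  fix x assume x: "x \<in> ?S"
  have ac: "absolutely_continuous_on_Icc (x - 1) (x + 1) F"
    using F by (simp add: locally_absolutely_continuous_def)
  have re: "\<bar>Re (F z) - Re (F y)\<bar> \<le> cmod (F z - F y)" for y z
    using abs_Re_le_cmod[of "F z - F y"] by simp
  have im: "\<bar>Im (F z) - Im (F y)\<bar> \<le> cmod (F z - F y)" for y z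
    using abs_Im_le_cmod[of "F z - F y"] by simp
  obtain \<delta>1 where \<delta>1: "\<delta>1 > 0" "\<And>u v. \<lbrakk>x - 1 \<le> u; v \<le> x + 1; v - u < \<delta>1\<rbrakk>
      \<Longrightarrow> variation_bounded u v (\<lambda>x. Re (F x))"
    by (rule absolutely_continuous_variation_bounded[OF ac re that])
  obtain \<delta>2 where \<delta>2: "\<delta>2 > 0" "\<And>u v. \<lbrakk>x - 1 \<le> u; v \<le> x + 1; v - u < \<delta>2\<rbrakk>
      \<Longrightarrow> variation_bounded u v (\<lambda>x. Im (F x))"
    by (rule absolutely_continuous_variation_bounded[OF ac im that])
  define d where "d = min 1 (min \<delta>1 \<delta>2 / 3)"
  have d: "d > 0" "d \<le> 1" "2 * d < \<delta>1" "2 * d < \<delta>2" using \<delta>1 \<delta>2 by (auto simp: d_def)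
  let ?I = "{x - d<..<x + d}"
  define N1 where "N1 = {y\<in>?I. \<not> (\<exists>l. ((\<lambda>x. Re (F x)) has_real_derivative l) (at y))}"
  define N2 where "N2 = {y\<in>?I. \<not> (\<exists>l. ((\<lambda>x. Im (F x)) has_real_derivative l) (at y))}"
  have "negligible (N1 \<union> N2)"
    unfolding N1_def N2_def using d
    by (intro negligible_Un variation_bounded_differentiable_AE \<delta>1 \<delta>2) auto
  moreover have "?S \<inter> ?I \<subseteq> N1 \<union> N2"
  proof
    fix y assume y: "y \<in> ?S \<inter> ?I"
    show "y \<in> N1 \<union> N2"
    proof (rule ccontr)
      assume "y \<notin> N1 \<union> N2"
      then obtain l1 l2 where l: "((\<lambda>x. Re (F x)) has_real_derivative l1) (at y)"
          "((\<lambda>x. Im (F x)) has_real_derivative l2) (at y)"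
        using y by (auto simp: N1_def N2_def)
      have "((\<lambda>x. of_real (Re (F x)) + \<i> * of_real (Im (F x))) has_vector_derivative
          (of_real l1 + \<i> * of_real l2)) (at y)"
        using l by (intro has_vector_derivative_add has_vector_derivative_mult_right
            has_vector_derivative_of_real)
      then show False using y by (auto simp flip: complex_eq)
    qed
  qed
  ultimately have "negligible (?S \<inter> ?I)" by (rule negligible_subset)
  moreover have "openin (top_of_set ?S) (?S \<inter> ?I)" by (simp add: openin_open_Int)
  ultimately show "\<exists>U. openin (top_of_set ?S) U \<and> x \<in> U \<and> negligible U"
    using x d(1) by (intro exI[of _ "?S \<inter> ?I"]) auto
qed

section \<open>The fundamental theorem of calculus for absolutely continuous functions\<close>

lemma sum_lengths_le_measure:
  fixes P :: "(real \<times> real) set"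
  assumes "finite P" "U \<in> lmeasurable" "disjoint_family_on (\<lambda>(x, y). {x<..<y}) P"
    and P: "\<And>x y. (x, y) \<in> P \<Longrightarrow> x \<le> y \<and> {x<..<y} \<subseteq> U"
  shows "(\<Sum>(x, y)\<in>P. y - x) \<le> measure lebesgue U"
proof -
  have "(\<Sum>(x, y)\<in>P. y - x) = (\<Sum>k\<in>P. measure lebesgue (case k of (x, y) \<Rightarrow> {x<..<y}))"
    by (rule sum.cong) (auto dest: P)
  also have "\<dots> = measure lebesgue (\<Union>k\<in>P. case k of (x, y) \<Rightarrow> {x<..<y})"
    using assms by (intro measure_UNION'[symmetric])
      (auto simp: disjoint_family_on_def pairwise_def disjnt_def split: prod.splits)
  also have "\<dots> \<le> measure lebesgue U"
    using assms(2) P by (intro measure_mono_fmeasurable) (auto simp: assms(1) split: prod.splits intro!: sets.finite_UN)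
  finally show ?thesis .
qed

text \<open>On a tagged interval whose tag lies in the exceptional set, the increment of \<open>F\<close> is controlled
  by absolute continuity: the gauge confines these intervals to an open set of small measure.\<close>

lemma absolutely_continuous_has_integral_derivative:
  assumes F: "absolutely_continuous_on_Icc a b F" and ab: "a \<le> b" and N: "negligible N"
    and deriv: "\<And>x. x \<in> {a..b} - N \<Longrightarrow> (F has_vector_derivative g x) (at x)"
  shows "(g has_integral (F b - F a)) {a..b}"
proof (rule has_integral_spike[OF N])
  \<comment> \<open>With value 0 on \<open>N\<close>, an interval tagged in \<open>N\<close>
    contributes only the increment of \<open>F\<close> to the error.\<close>
  define h where "h = (\<lambda>x. if x \<in> N then 0 else g x)"
  show "g x = h x" if "x \<in> {a..b} - N" for x using that by (simp add: h_def)
  show "(h has_integral (F b - F a)) {a..b}"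
    unfolding has_integral_real
  proof (intro allI impI)
    fix e :: real assume e: "e > 0"
    define e1 where "e1 = e / (2 * (b - a + 1))"
    have e1: "e1 > 0" "e1 * (b - a) \<le> e / 2"
      using e ab by (auto simp: e1_def field_simps)
    have "\<forall>x. \<exists>d>0. x \<in> {a..b} - N \<longrightarrow>
         (\<forall>y. norm (y-x) < d \<longrightarrow> norm (F y - F x - (y-x) *\<^sub>R g x) \<le> e1 * norm (y-x))"
      using deriv[unfolded has_vector_derivative_def has_derivative_within_alt] e1(1)
      by (metis UNIV_I zero_less_one)
    then obtain d where d: "\<And>x. 0 < d x" "\<And>x y. \<lbrakk>x \<in> {a..b} - N; norm (y-x) < d x\<rbrakk>
        \<Longrightarrow> norm (F y - F x - (y-x) *\<^sub>R g x) \<le> e1 * norm (y-x)"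
      by metis
    obtain \<delta> where \<delta>: "\<delta> > 0" and ac: "\<And>P. \<lbrakk>finite P; \<forall>(x, y)\<in>P. a \<le> x \<and> x \<le> y \<and> y \<le> b;
        disjoint_family_on (\<lambda>(x, y). {x<..<y}) P; (\<Sum>(x, y)\<in>P. y - x) < \<delta>\<rbrakk>
        \<Longrightarrow> (\<Sum>(x, y)\<in>P. cmod (F y - F x)) < e / 2"
      by (rule absolutely_continuous_on_IccE[OF F half_gt_zero[OF e] that])
    obtain U where U: "open U" "N \<subseteq> U" "U - N \<in> lmeasurable" "emeasure lebesgue (U - N) < ennreal \<delta>"
      using sets_lebesgue_outer_open[OF negligible_imp_sets[OF N] \<delta>] by blast
    have "(U - N) \<union> N = U" using U by blast
    then have mU: "U \<in> lmeasurable" "measure lebesgue U < \<delta>"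
      using lmeasurable_Un_negligible[OF U(3) N] U(3,4) \<delta>
      by (simp_all add: emeasure_eq_measure2 ennreal_less_iff)
    define \<gamma> where "\<gamma> = (\<lambda>x. if x \<in> N then U else ball x (d x))"
    show "\<exists>\<gamma>. gauge \<gamma> \<and> (\<forall>p. p tagged_division_of {a..b} \<and> \<gamma> fine p \<longrightarrow>
            norm ((\<Sum>(x, k)\<in>p. measure lborel k *\<^sub>R h x) - (F b - F a)) < e)"
    proof (intro exI[of _ \<gamma>] conjI allI impI; (elim conjE)?)
      show "gauge \<gamma>" using U d by (auto simp: gauge_def \<gamma>_def)
    next
      fix p assume p: "p tagged_division_of {a..b}" "\<gamma> fine p"
      note pd = tagged_division_ofD[OF p(1)]
      have pk: "k = {Inf k..Sup k} \<and> Inf k \<le> x \<and> x \<le> Sup k \<and> k \<subseteq> {a..b} \<and> k \<subseteq> \<gamma> x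
          \<and> measure lborel k = Sup k - Inf k" if ik: "(x, k) \<in> p" for x k
      proof -
        obtain u v where uv: "k = {u..v}" using pd(4)[OF ik] by auto
        moreover have "u \<le> x" "x \<le> v" using pd(2)[OF ik] uv by auto
        ultimately show ?thesis
          using pd(3)[OF ik] p(2) ik by (auto simp: fine_def)
      qed
      define err where "err = (\<lambda>(x, k). measure lborel k *\<^sub>R h x - (F (Sup k) - F (Inf k)))"
      define p1 where "p1 = {(x, k)\<in>p. x \<notin> N}"
      \<comment> \<open>Degenerate intervals tagged in \<open>N\<close> carry no error. Without them
        the interiors are nonempty and disjoint, so different tagged intervals have different
        endpoints and \<open>Q\<close> below is injective.\<close>
      define p2 where "p2 = {(x, k)\<in>p. x \<in> N \<and> Inf k < Sup k}"
      have fin: "finite p" "finite p1" "finite p2"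
        using pd(1) by (auto simp: p1_def p2_def intro: finite_subset[of _ p])
      have "norm ((\<Sum>(x, k)\<in>p. measure lborel k *\<^sub>R h x) - (F b - F a)) = norm (\<Sum>t\<in>p. err t)"
        unfolding additive_tagged_division_1[OF ab p(1), of F, symmetric] err_def
        by (simp add: sum_subtractf case_prod_beta)
      also have "(\<Sum>t\<in>p. err t) = (\<Sum>t\<in>p1 \<union> p2. err t)"
      proof (rule sum.mono_neutral_right)
        show "\<forall>t\<in>p - (p1 \<union> p2). err t = 0"
        proof
          fix t assume t: "t \<in> p - (p1 \<union> p2)"
          obtain x k where xk: "t = (x, k)" by (cases t)
          then have "(x, k) \<in> p" "x \<in> N" "\<not> Inf k < Sup k" using t by (auto simp: p1_def p2_def)
          moreover then have "Inf k = Sup k" using pk by force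
          ultimately show "err t = 0" using pk[of x k] by (simp add: err_def xk)
        qed
      qed (auto simp: fin p1_def p2_def)
      also have "\<dots> = (\<Sum>t\<in>p1. err t) + (\<Sum>t\<in>p2. err t)"
        using fin by (intro sum.union_disjoint) (auto simp: p1_def p2_def)
      also have "norm \<dots> \<le> (\<Sum>t\<in>p1. norm (err t)) + (\<Sum>t\<in>p2. norm (err t))"
        by (intro order_trans[OF norm_triangle_ineq] add_mono norm_sum)
      also have "(\<Sum>t\<in>p1. norm (err t)) \<le> e / 2"
      proof -
        have "(\<Sum>t\<in>p1. norm (err t)) \<le> (\<Sum>(x, k)\<in>p1. e1 * (Sup k - Inf k))"
        proof (rule sum_mono, clarify)
          fix x k assume xk: "(x, k) \<in> p1"
          then have "(x, k) \<in> p" "x \<notin> N" by (auto simp: p1_def)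
          note k = pk[OF this(1)]
          have "Inf k \<in> k" "Sup k \<in> k" using k by (metis atLeastAtMost_iff order_refl order_trans)+
          then have "Inf k \<in> ball x (d x)" "Sup k \<in> ball x (d x)"
            using k \<open>x \<notin> N\<close> by (auto simp: \<gamma>_def)
          then have dd: "norm (Inf k - x) < d x" "norm (Sup k - x) < d x"
            by (auto simp: dist_real_def)
          have "x \<in> {a..b} - N" using k pd(2)[OF \<open>(x, k) \<in> p\<close>] \<open>x \<notin> N\<close> by auto
          note b1 = d(2)[OF this dd(1)] and b2 = d(2)[OF this dd(2)]
          have mk: "measure lborel k = Sup k - Inf k" using k by blast
          \<comment> \<open>The error splits at the tag. As the tag lies in \<open>k\<close>, its
            distances to the two endpoints add up to the length of \<open>k\<close>, and so do the
            two linear approximation bounds, up to the factor \<open>e1\<close>.\<close>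
          have "err (x, k) = (F (Inf k) - F x - (Inf k - x) *\<^sub>R g x)
              - (F (Sup k) - F x - (Sup k - x) *\<^sub>R g x)"
            unfolding err_def prod.case mk using \<open>x \<notin> N\<close> by (simp add: h_def algebra_simps)
          then have "norm (err (x, k)) \<le> norm (F (Inf k) - F x - (Inf k - x) *\<^sub>R g x)
              + norm (F (Sup k) - F x - (Sup k - x) *\<^sub>R g x)"
            by (simp only: norm_triangle_ineq4)
          also have "\<dots> \<le> e1 * norm (Inf k - x) + e1 * norm (Sup k - x)"
            by (rule add_mono[OF b1 b2])
          also have "\<dots> = e1 * (Sup k - Inf k)"
            using k by (simp add: algebra_simps)
          finally show "norm (err (x, k)) \<le> e1 * (Sup k - Inf k)" .
        qed
        also have "\<dots> \<le> (\<Sum>(x, k)\<in>p. e1 * (Sup k - Inf k))"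
        proof (rule sum_mono2)
          show "0 \<le> (case t of (x, k) \<Rightarrow> e1 * (Sup k - Inf k))" if "t \<in> p - p1" for t
            using that e1(1) pk by (force split: prod.splits)
        qed (auto simp: fin p1_def)
        also have "\<dots> = e1 * (b - a)"
          using additive_tagged_division_1[OF ab p(1), of "\<lambda>x. x"]
          by (simp add: case_prod_beta flip: sum_distrib_left)
        finally show ?thesis using e1(2) by linarith
      qed
      also have "(\<Sum>t\<in>p2. norm (err t)) < e / 2"
      proof -
        define Q where "Q = (\<lambda>(x::real, k::real set). (Inf k, Sup k))"
        have int: "{Inf k<..<Sup k} \<inter> {Inf l<..<Sup l} = {}"
          if "(x, k) \<in> p" "(y, l) \<in> p" "(x, k) \<noteq> (y, l)" for x k y l
        proof -
          have "interior k = {Inf k<..<Sup k}" "interior l = {Inf l<..<Sup l}"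
            using pk[OF that(1)] pk[OF that(2)] by (metis interior_atLeastAtMost_real)+
          then show ?thesis using pd(5)[OF that] by simp
        qed
        have inj: "inj_on Q p2"
        proof (rule inj_onI, clarify)
          fix x k y l assume xy: "(x, k) \<in> p2" "(y, l) \<in> p2" "Q (x, k) = Q (y, l)"
          show "x = y \<and> k = l"
          proof (rule ccontr)
            assume "\<not> (x = y \<and> k = l)"
            then have "{Inf k<..<Sup k} \<inter> {Inf l<..<Sup l} = {}"
              using int[of x k y l] xy by (auto simp: p2_def)
            then show False using xy by (auto simp: Q_def p2_def)
          qed
        qed
        have disj: "disjoint_family_on (\<lambda>(x, y). {x<..<y}) (Q ` p2)"
          unfolding disjoint_family_on_def Q_def p2_def using int
          by (clarsimp; metis)
        have "(\<Sum>(x, y)\<in>Q ` p2. cmod (F y - F x)) < e / 2"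
        proof (rule ac[OF _ _ disj])
          show "\<forall>(x, y)\<in>Q ` p2. a \<le> x \<and> x \<le> y \<and> y \<le> b"
          proof (clarsimp simp: Q_def)
            fix x k assume "(x, k) \<in> p2"
            then have k: "k = {Inf k..Sup k}" "Inf k < Sup k" "k \<subseteq> {a..b}"
              using pk[of x k] by (auto simp: p2_def)
            then have "Inf k \<in> {a..b}" "Sup k \<in> {a..b}"
              by (metis atLeastAtMost_iff less_imp_le order_refl subsetD)+
            then show "a \<le> Inf k \<and> Inf k \<le> Sup k \<and> Sup k \<le> b" using k(2) by simp
          qed
          have "(\<Sum>(x, y)\<in>Q ` p2. y - x) \<le> measure lebesgue U"
          proof (rule sum_lengths_le_measure[OF _ mU(1) disj])
            fix s t assume "(s, t) \<in> Q ` p2"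
            then obtain x k where xk: "(x, k) \<in> p" "x \<in> N" "s = Inf k" "t = Sup k" "s < t"
              by (auto simp: Q_def p2_def)
            then have "{s..t} \<subseteq> U" using pk[OF xk(1)] by (auto simp: \<gamma>_def)
            then show "s \<le> t \<and> {s<..<t} \<subseteq> U" using xk(5) by auto
          qed (simp add: fin)
          then show "(\<Sum>(x, y)\<in>Q ` p2. y - x) < \<delta>" using mU by linarith
        qed (simp add: fin)
        then have "(\<Sum>(x, k)\<in>p2. cmod (F (Sup k) - F (Inf k))) < e / 2"
          by (subst (asm) sum.reindex[OF inj]) (simp add: Q_def case_prod_beta)
        moreover have "norm (err t) = (case t of (x, k) \<Rightarrow> cmod (F (Sup k) - F (Inf k)))"
          if "t \<in> p2" for t
          using that by (auto simp: err_def h_def p2_def norm_minus_commute split: prod.splits)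
        ultimately show ?thesis by simp
      qed
      finally show "norm ((\<Sum>(x, k)\<in>p. measure lborel k *\<^sub>R h x) - (F b - F a)) < e" by simp
    qed
  qed
qed

text \<open>Integration by parts needs the product itself to be absolutely continuous. Its increment
  is \<open>w y * (F y - F x) + (w y - w x) * F x\<close>, where the first term is controlled by
  absolute continuity of \<open>F\<close> and the second by the Lipschitz bound on
  \<open>w\<close>.\<close>

lemma absolutely_continuous_on_Icc_mult:
  assumes F: "absolutely_continuous_on_Icc a b F"
    and nn: "0 \<le> W" "0 \<le> M" "0 \<le> L"
    and W: "\<And>x. x \<in> {a..b} \<Longrightarrow> \<bar>w x\<bar> \<le> W"
    and M: "\<And>x. x \<in> {a..b} \<Longrightarrow> cmod (F x) \<le> M"
    and L: "\<And>x y. \<lbrakk>x \<in> {a..b}; y \<in> {a..b}; x \<le> y\<rbrakk> \<Longrightarrow> \<bar>w y - w x\<bar> \<le> L * (y - x)"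
  shows "absolutely_continuous_on_Icc a b (\<lambda>x. of_real (w x) * F x)"
  unfolding absolutely_continuous_on_Icc_def
proof (intro allI impI)
  fix e :: real assume e: "e > 0"
  \<comment> \<open>The \<open>+ 1\<close> in \<open>e1\<close> and in \<open>\<delta>2\<close>
    keeps the denominators positive when \<open>W\<close> or \<open>M * L\<close> vanishes.\<close>
  define e1 where "e1 = e / (2 * (W + 1))"
  define \<delta>2 where "\<delta>2 = e / (2 * (M * L + 1))"
  have LM: "0 \<le> M * L" using nn by simp
  have e1: "e1 > 0" "W * e1 \<le> e / 2" using e nn by (auto simp: e1_def field_simps)
  have \<delta>2: "\<delta>2 > 0" "M * L * \<delta>2 < e / 2"
    using e LM by (auto simp: \<delta>2_def field_simps add_pos_nonneg add_nonneg_pos)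
  obtain \<delta>1 where \<delta>1: "\<delta>1 > 0" and ac: "\<And>P. \<lbrakk>finite P; \<forall>(x, y)\<in>P. a \<le> x \<and> x \<le> y \<and> y \<le> b;
        disjoint_family_on (\<lambda>(x, y). {x<..<y}) P; (\<Sum>(x, y)\<in>P. y - x) < \<delta>1\<rbrakk>
        \<Longrightarrow> (\<Sum>(x, y)\<in>P. cmod (F y - F x)) < e1"
    by (rule absolutely_continuous_on_IccE[OF F e1(1) that])
  show "\<exists>\<delta>>0. \<forall>P. finite P \<and> (\<forall>(x, y)\<in>P. a \<le> x \<and> x \<le> y \<and> y \<le> b) \<and>
        disjoint_family_on (\<lambda>(x, y). {x<..<y}) P \<and> (\<Sum>(x, y)\<in>P. y - x) < \<delta>
        \<longrightarrow> (\<Sum>(x, y)\<in>P. cmod (of_real (w y) * F y - of_real (w x) * F x)) < e"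
  proof (intro exI[of _ "min \<delta>1 \<delta>2"] conjI allI impI; (elim conjE)?)
    fix P :: "(real \<times> real) set"
    assume P: "finite P" "\<forall>(x, y)\<in>P. a \<le> x \<and> x \<le> y \<and> y \<le> b"
        "disjoint_family_on (\<lambda>(x, y). {x<..<y}) P" "(\<Sum>(x, y)\<in>P. y - x) < min \<delta>1 \<delta>2"
    have "(\<Sum>(x, y)\<in>P. cmod (of_real (w y) * F y - of_real (w x) * F x))
        \<le> (\<Sum>(x, y)\<in>P. W * cmod (F y - F x) + M * L * (y - x))"
    proof (rule sum_mono, clarify)
      fix x y assume "(x, y) \<in> P"
      then have xy: "x \<in> {a..b}" "y \<in> {a..b}" "x \<le> y" using P(2) by auto
      have "of_real (w y) * F y - of_real (w x) * F x
          = of_real (w y) * (F y - F x) + of_real (w y - w x) * F x"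
        by (simp add: algebra_simps)
      then have "cmod (of_real (w y) * F y - of_real (w x) * F x)
          \<le> \<bar>w y\<bar> * cmod (F y - F x) + \<bar>w y - w x\<bar> * cmod (F x)"
        using norm_triangle_ineq[of "of_real (w y) * (F y - F x)" "of_real (w y - w x) * F x"]
        by (simp only: norm_mult norm_of_real)
      also have "\<dots> \<le> W * cmod (F y - F x) + (L * (y - x)) * M"
        using xy nn by (intro add_mono mult_mono W M L) auto
      finally show "cmod (of_real (w y) * F y - of_real (w x) * F x)
          \<le> W * cmod (F y - F x) + M * L * (y - x)" by (simp add: mult_ac)
    qed
    also have "\<dots> = W * (\<Sum>(x, y)\<in>P. cmod (F y - F x)) + M * L * (\<Sum>(x, y)\<in>P. y - x)"
      by (simp add: sum.distrib sum_distrib_left case_prod_beta)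
    also have "\<dots> \<le> W * e1 + M * L * \<delta>2"
      using ac[OF P(1-3)] P(4) nn by (intro add_mono mult_left_mono LM) auto
    also have "\<dots> < e" using e1 \<delta>2 by linarith
    finally show "(\<Sum>(x, y)\<in>P. cmod (of_real (w y) * F y - of_real (w x) * F x)) < e" .
  qed (use \<delta>1 \<delta>2 in auto)
qed

lemma locally_absolutely_continuous_isCont:
  assumes "locally_absolutely_continuous F"
  shows "isCont F x"
  unfolding continuous_at_eps_delta
proof (intro allI impI)
  fix e :: real assume e: "e > 0"
  have F: "absolutely_continuous_on_Icc (x - 1) (x + 1) F"
    using assms by (simp add: locally_absolutely_continuous_def)
  obtain \<delta> where \<delta>: "\<delta> > 0" and ac: "\<And>P. \<lbrakk>finite P; \<forall>(s, t)\<in>P. x - 1 \<le> s \<and> s \<le> t \<and> t \<le> x + 1;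
        disjoint_family_on (\<lambda>(s, t). {s<..<t}) P; (\<Sum>(s, t)\<in>P. t - s) < \<delta>\<rbrakk>
        \<Longrightarrow> (\<Sum>(s, t)\<in>P. cmod (F t - F s)) < e"
    by (rule absolutely_continuous_on_IccE[OF F e that])
  show "\<exists>d>0. \<forall>y. dist y x < d \<longrightarrow> dist (F y) (F x) < e"
  proof (intro exI[of _ "min 1 \<delta>"] conjI allI impI)
    fix y assume y: "dist y x < min 1 \<delta>"
    have "(\<Sum>(s, t)\<in>{(min x y, max x y)}. cmod (F t - F s)) < e"
      by (rule ac) (use y in \<open>auto simp: disjoint_family_on_def dist_real_def\<close>)
    then show "dist (F y) (F x) < e"
      by (auto simp: dist_norm min_def max_def norm_minus_commute split: if_splits)
  qed (use \<delta> in auto)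
qed

lemma locally_absolutely_continuous_FTC:
  assumes "locally_absolutely_continuous F" "a \<le> b"
  shows "((\<lambda>x. vector_derivative F (at x)) has_integral (F b - F a)) {a..b}"
proof (rule absolutely_continuous_has_integral_derivative[OF _ assms(2)])
  show "absolutely_continuous_on_Icc a b F"
    using assms(1) by (simp add: locally_absolutely_continuous_def)
  show "negligible {x. \<not> (\<exists>l. (F has_vector_derivative l) (at x))}"
    by (rule locally_absolutely_continuous_differentiable_AE[OF assms(1)])
qed (auto simp: vector_derivative_at)

text \<open>\<open>F\<close> is the integral of \<open>vector_derivative F\<close>, whatever values
  that total function takes on the exceptional null set; an integral of a continuous function is
  differentiable everywhere.\<close>

lemma locally_absolutely_continuous_C1:
  assumes F: "locally_absolutely_continuous F"
    and cont: "\<And>x. isCont (\<lambda>x. vector_derivative F (at x)) x"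
  shows "(F has_vector_derivative vector_derivative F (at x)) (at x)"
proof -
  let ?g = "\<lambda>x. vector_derivative F (at x)"
  have g: "continuous_on {x - 1..x + 1} ?g"
    using cont by (simp add: continuous_at_imp_continuous_on)
  have "((\<lambda>u. F (x - 1) + integral {x - 1..u} ?g) has_vector_derivative 0 + ?g x) (at x within {x - 1..x + 1})"
    by (intro has_vector_derivative_add has_vector_derivative_const
        integral_has_vector_derivative[OF g]) auto
  moreover have "F (x - 1) + integral {x - 1..u} ?g = F u" if "u \<in> {x - 1..x + 1}" for u
    using integral_unique[OF locally_absolutely_continuous_FTC[OF F, of "x - 1" u]] that by auto
  ultimately have "(F has_vector_derivative ?g x) (at x within {x - 1..x + 1})"
    by (auto intro: has_vector_derivative_transform[rotated 2])
  then show ?thesis by (simp add: at_within_Icc_at)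
qed

section \<open>Integration by parts on a single cell\<close>

lemma continuous_on_Icc_norm_bound:
  fixes f :: "real \<Rightarrow> 'a::real_normed_vector"
  assumes "continuous_on {a..b} f"
  obtains B where "0 \<le> B" "\<And>x. x \<in> {a..b} \<Longrightarrow> norm (f x) \<le> B"
proof -
  have "bounded (f ` {a..b})"
    using assms by (intro compact_imp_bounded compact_continuous_image) auto
  then obtain B where "B > 0" "\<forall>x\<in>f ` {a..b}. norm x \<le> B" unfolding bounded_pos by blast
  then show ?thesis using that[of B] by auto
qed

text \<open>Two integrations by parts, with \<open>w'' = 1\<close>. The first, for
  \<open>w * g\<close>, rests on absolute continuity because \<open>g\<close> is differentiable only
  almost everywhere; the second, for \<open>w' * \<phi>\<close>, is classical.\<close>

lemma trapezoid_second_derivative: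
  fixes \<phi> :: "real \<Rightarrow> complex"
  assumes \<phi>: "\<And>x. (\<phi> has_vector_derivative g x) (at x)"
    and g: "locally_absolutely_continuous g" and "0 < h" and b: "b = c + h"
  defines "w \<equiv> \<lambda>t. (t - c) * (t - b) / 2 + h\<^sup>2 / 12"
  shows "((\<lambda>t. of_real (w t) * vector_derivative g (at t)) has_integral
           (of_real (h\<^sup>2 / 12) * (g b - g c) - of_real (h / 2) * (\<phi> b + \<phi> c) + integral {c..b} \<phi>))
         {c..b}"
proof -
  let ?g' = "\<lambda>t. vector_derivative g (at t)"
  \<comment> \<open>\<open>w'\<close> is \<open>- h / 2\<close> and \<open>h / 2\<close> at the ends
    of the cell, which produces the trapezoidal weights. \<open>w\<close> takes the same value
    \<open>h\<^sup>2 / 12\<close> at both ends, so the terms in \<open>g\<close> will telescope from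
    cell to cell.\<close>
  define w' where "w' = (\<lambda>t. t - (b + c) / 2)"
  have cb: "c \<le> b" using assms by simp
  have w': "(w has_real_derivative w' t) (at t)" for t
    unfolding w_def w'_def by (auto intro!: derivative_eq_intros simp: field_simps)
  have gc: "continuous_on A g" for A
    using locally_absolutely_continuous_isCont[OF g] by (simp add: continuous_at_imp_continuous_on)
  have \<phi>c: "continuous_on A \<phi>" for A
    using has_vector_derivative_continuous[OF \<phi>] by (simp add: continuous_at_imp_continuous_on)
  obtain M where M: "0 \<le> M" "\<And>x. x \<in> {c..b} \<Longrightarrow> cmod (g x) \<le> M"
    by (rule continuous_on_Icc_norm_bound[OF gc that])
  have wc: "continuous_on {c..b} w" unfolding w_def by (intro continuous_intros) auto
  obtain W where W: "0 \<le> W" "\<And>x. x \<in> {c..b} \<Longrightarrow> norm (w x) \<le> W"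
    by (rule continuous_on_Icc_norm_bound[OF wc that])
  have "absolutely_continuous_on_Icc c b (\<lambda>t. of_real (w t) * g t)"
  proof (rule absolutely_continuous_on_Icc_mult[OF _ W(1) M(1) less_imp_le[OF \<open>0 < h\<close>] W(2)[unfolded real_norm_def] M(2)])
    show "absolutely_continuous_on_Icc c b g"
      using g by (simp add: locally_absolutely_continuous_def)
    fix x y assume xy: "x \<in> {c..b}" "y \<in> {c..b}" "x \<le> y"
    have "w y - w x = ((x + y) / 2 - (b + c) / 2) * (y - x)"
      by (simp add: w_def field_simps)
    then have "\<bar>w y - w x\<bar> = \<bar>(x + y) / 2 - (b + c) / 2\<bar> * (y - x)"
      using xy by (simp only: abs_mult)
    moreover have "\<bar>(x + y) / 2 - (b + c) / 2\<bar> \<le> h" using xy b by (auto simp: abs_le_iff field_simps)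
    ultimately show "\<bar>w y - w x\<bar> \<le> h * (y - x)"
      using xy(3) by (simp only: mult_right_mono diff_ge_0_iff_ge)
  qed
  then have 1: "((\<lambda>t. of_real (w t) * ?g' t + of_real (w' t) * g t) has_integral
      (of_real (w b) * g b - of_real (w c) * g c)) {c..b}"
  proof (rule absolutely_continuous_has_integral_derivative[OF _ cb])
    show "negligible {x. \<not> (\<exists>l. (g has_vector_derivative l) (at x))}"
      by (rule locally_absolutely_continuous_differentiable_AE[OF g])
    fix x assume "x \<in> {c..b} - {x. \<not> (\<exists>l. (g has_vector_derivative l) (at x))}"
    then have "(g has_vector_derivative ?g' x) (at x)" by (auto simp: vector_derivative_at)
    then show "((\<lambda>t. of_real (w t) * g t) has_vector_derivative
        of_real (w x) * ?g' x + of_real (w' x) * g x) (at x)"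
      by (intro has_vector_derivative_mult has_vector_derivative_of_real w')
  qed
  have 2: "((\<lambda>t. of_real (w' t) * g t + of_real 1 * \<phi> t) has_integral
      (of_real (w' b) * \<phi> b - of_real (w' c) * \<phi> c)) {c..b}"
  proof (rule fundamental_theorem_of_calculus[OF cb])
    fix x
    have dw': "(w' has_real_derivative 1) (at x)"
      unfolding w'_def by (auto intro!: derivative_eq_intros)
    show "((\<lambda>t. of_real (w' t) * \<phi> t) has_vector_derivative
        of_real (w' x) * g x + of_real 1 * \<phi> x) (at x within {c..b})"
      by (rule has_vector_derivative_at_within[OF
            has_vector_derivative_mult[OF has_vector_derivative_of_real[OF dw'] \<phi>]])
  qed
  have 3: "(\<phi> has_integral integral {c..b} \<phi>) {c..b}"
    using \<phi>c by (intro integrable_integral integrable_continuous_real)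
  \<comment> \<open>Subtracting the second identity removes \<open>w' * g\<close>, and adding \<phi>
    cancels the term coming from \<open>w'' = 1\<close>.\<close>
  have "((\<lambda>t. (of_real (w t) * ?g' t + of_real (w' t) * g t) - (of_real (w' t) * g t + of_real 1 * \<phi> t) + \<phi> t)
      has_integral (of_real (w b) * g b - of_real (w c) * g c)
        - (of_real (w' b) * \<phi> b - of_real (w' c) * \<phi> c) + integral {c..b} \<phi>) {c..b}"
    by (intro has_integral_add has_integral_diff 1 2 3)
  then have I: "((\<lambda>t. of_real (w t) * ?g' t) has_integral (of_real (w b) * g b - of_real (w c) * g c)
        - (of_real (w' b) * \<phi> b - of_real (w' c) * \<phi> c) + integral {c..b} \<phi>) {c..b}"
    by (simp add: algebra_simps)
  have ends: "w b = h\<^sup>2 / 12" "w c = h\<^sup>2 / 12" "w' b = h / 2" "w' c = - (h / 2)"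
    by (auto simp: w_def w'_def b field_simps)
  show ?thesis
    by (rule has_integral_eq_rhs[OF I]) (simp add: ends field_simps)
qed

section \<open>The remainder of the trapezoidal rule\<close>

text \<open>The periodic Peano kernel \<open>h\<^sup>2 / 2 \<cdot> B\<^sub>2({t / h})\<close> with \<open>B\<^sub>2\<close> the second Bernoulli polynomial.\<close>

definition peano_kernel :: "real \<Rightarrow> real \<Rightarrow> real" where
  "peano_kernel h t = (let s = t - h * of_int \<lfloor>t / h\<rfloor> in s * (s - h) / 2 + h\<^sup>2 / 12)"

text \<open>For \<open>s\<close> in \<open>[0, h]\<close> the product \<open>s * (s - h)\<close>
  lies between \<open>- h\<^sup>2 / 4\<close> and 0, so the kernel lies between
  \<open>- h\<^sup>2 / 24\<close> and \<open>h\<^sup>2 / 12\<close>, the latter attained at the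
  nodes.\<close>

lemma abs_peano_kernel_le:
  assumes "0 < h"
  shows "\<bar>peano_kernel h t\<bar> \<le> h\<^sup>2 / 12"
proof -
  define s where "s = t - h * of_int \<lfloor>t / h\<rfloor>"
  have s: "0 \<le> s" "s \<le> h"
    using floor_divide_lower[OF assms, of t] floor_divide_upper[OF assms, of t]
    by (auto simp: s_def algebra_simps)
  have "s * (s - h) \<le> 0" using s by (simp add: mult_nonneg_nonpos)
  moreover have "0 \<le> (s - h / 2)\<^sup>2" by simp
  then have "- (h\<^sup>2 / 4) \<le> s * (s - h)" by (simp add: power2_eq_square field_simps)
  ultimately show ?thesis
    unfolding peano_kernel_def Let_def s_def[symmetric]
    using zero_le_power2[of h] by (intro abs_leI; linarith)
qed

text \<open>The cell is closed, as the integrals over cells are. At its right end the floor has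
  already jumped to \<open>k + 1\<close>; the formula survives because the polynomial has equal
  values at both ends.\<close>

lemma peano_kernel_eq:
  assumes "0 < h" "t \<in> {h * of_int k..h * of_int k + h}"
  shows "peano_kernel h t = (t - h * of_int k) * (t - (h * of_int k + h)) / 2 + h\<^sup>2 / 12"
proof (cases "t = h * of_int k + h")
  case True
  then have "t / h = of_int (k + 1)" using assms(1) by (simp add: field_simps)
  then have "\<lfloor>t / h\<rfloor> = k + 1" by (metis floor_of_int)
  then show ?thesis using True by (simp add: peano_kernel_def algebra_simps)
next
  case False
  then have "\<lfloor>t / h\<rfloor> = k"
    using assms by (intro floor_unique) (auto simp: field_simps)
  then show ?thesis by (simp add: peano_kernel_def Let_def algebra_simps)
qed

lemma peano_kernel_measurable [measurable]: "peano_kernel h \<in> borel_measurable borel"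
proof -
  have [measurable]: "(\<lambda>t. real_of_int \<lfloor>t / h\<rfloor>) \<in> borel_measurable borel"
    by (rule measurable_compose[OF _ borel_measurable_real_floor]) simp
  show ?thesis unfolding peano_kernel_def Let_def by simp
qed

text \<open>Adding up the cells gives interior nodes weight \<open>h\<close> and the two end nodes
  weight \<open>h / 2\<close>. The sum here counts every node fully, so half of the end terms is
  returned. For \<open>n = 0\<close> everything cancels.\<close>

lemma euler_maclaurin_finite:
  fixes \<phi> :: "real \<Rightarrow> complex"
  assumes \<phi>: "\<And>x. (\<phi> has_vector_derivative g x) (at x)"
    and g: "locally_absolutely_continuous g" and h: "0 < h"
  shows "((\<lambda>t. of_real (peano_kernel h t) * vector_derivative g (at t)) has_integral
           (of_real (h\<^sup>2 / 12) * (g (h * of_int (m + int n)) - g (h * of_int m))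
            + of_real (h / 2) * (\<phi> (h * of_int m) + \<phi> (h * of_int (m + int n)))
            - of_real h * (\<Sum>k=m..m + int n. \<phi> (h * of_int k))
            + integral {h * of_int m..h * of_int (m + int n)} \<phi>))
         {h * of_int m..h * of_int (m + int n)}"
proof (induction n)
  case 0
  show ?case using has_integral_refl(2) by (simp add: algebra_simps)
next
  case (Suc n)
  define k where "k = m + int n"
  have k1: "m + int (Suc n) = k + 1" by (simp add: k_def)
  have mk: "m \<le> k" by (simp add: k_def)
  let ?b = "h * of_int k + h"
  have b: "h * of_int (k + 1) = ?b" by (simp add: algebra_simps)
  have le: "h * of_int m \<le> h * of_int k" "h * of_int k \<le> ?b" using h mk by auto
  have "\<phi> integrable_on {h * of_int m..?b}"
    using has_vector_derivative_continuous[OF \<phi>]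
    by (intro integrable_continuous_real) (simp add: continuous_at_imp_continuous_on)
  note I = Henstock_Kurzweil_Integration.integral_combine[OF le this]
  have step: "((\<lambda>t. of_real (peano_kernel h t) * vector_derivative g (at t)) has_integral
      (of_real (h\<^sup>2 / 12) * (g ?b - g (h * of_int k)) - of_real (h / 2) * (\<phi> ?b + \<phi> (h * of_int k))
       + integral {h * of_int k..?b} \<phi>)) {h * of_int k..?b}"
    by (rule has_integral_eq[OF _ trapezoid_second_derivative[OF \<phi> g h refl]])
      (simp add: peano_kernel_eq[OF h])
  have S: "(\<Sum>j=m..k + 1. \<phi> (h * of_int j)) = (\<Sum>j=m..k. \<phi> (h * of_int j)) + \<phi> ?b"
  proof -
    have "{m..k + 1} = insert (k + 1) {m..k}" using mk by auto
    then have "(\<Sum>j=m..k + 1. \<phi> (h * of_int j))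
        = \<phi> (h * of_int (k + 1)) + (\<Sum>j=m..k. \<phi> (h * of_int j))" by simp
    then show ?thesis unfolding b by (simp only: add.commute)
  qed
  define a :: complex where "a = of_real (h / 2)"
  have a: "of_real h = a + a" by (simp add: a_def)
  define A :: complex where "A = of_real (h\<^sup>2 / 12)"
  show ?case
    unfolding k1 b S a a_def[symmetric] A_def[symmetric] I[symmetric]
    by (rule has_integral_eq_rhs[OF has_integral_combine[OF le
          Suc.IH[folded k_def a_def A_def, unfolded a] step[folded a_def A_def]]])
      (simp add: algebra_simps)
qed

section \<open>Null sets, limits of integrals over moving intervals, decay at infinity\<close>

lemma AE_lebesgue_imp_negligible:
  assumes "AE x in lebesgue. P x"
  shows "negligible {x. \<not> P x}"
proof -
  obtain N where "{x\<in>space lebesgue. \<not> P x} \<subseteq> N" "N \<in> null_sets lebesgue"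
    using assms by (auto simp: eventually_ae_filter)
  then show ?thesis
    by (auto simp: negligible_iff_null_sets intro: negligible_subset[of N, unfolded negligible_iff_null_sets])
qed

lemma continuous_AE_eq:
  fixes f g :: "real \<Rightarrow> complex"
  assumes "AE x in lebesgue. f x = g x" "continuous_on UNIV f" "continuous_on UNIV g"
  shows "f = g"
proof (rule ccontr)
  assume "f \<noteq> g"
  then have "{x. f x \<noteq> g x} \<noteq> {}" by auto
  moreover have "open {x. f x \<noteq> g x}" by (intro open_Collect_neq assms)
  ultimately show False
    using open_not_negligible AE_lebesgue_imp_negligible[OF assms(1)] by blast
qed

lemma integrable_lebesgue_Icc:
  fixes u :: "real \<Rightarrow> 'a::euclidean_space"
  assumes "integrable lebesgue u"
  shows "u absolutely_integrable_on {a..b}" "u integrable_on {a..b}"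
    "integral {a..b} u = (LINT x|lebesgue. indicator {a..b} x *\<^sub>R u x)"
proof -
  show "u absolutely_integrable_on {a..b}"
    unfolding set_integrable_def using assms by (intro integrable_mult_indicator) auto
  from set_lebesgue_integral_eq_integral[OF this]
  show "u integrable_on {a..b}" "integral {a..b} u = (LINT x|lebesgue. indicator {a..b} x *\<^sub>R u x)"
    by (simp_all add: set_lebesgue_integral_def)
qed

text \<open>Dominated convergence with bound \<open>norm (u x)\<close>. The parameter
  \<open>c\<close> covers both uses: 1 for intervals that exhaust the line, 0 for intervals that
  escape from every point.\<close>

lemma tendsto_integral_Icc:
  fixes u :: "real \<Rightarrow> 'a::euclidean_space"
  assumes u: "integrable lebesgue u"
    and ev: "\<And>x. \<forall>\<^sub>F N in sequentially. indicator {a N..b N} x = (c::real)"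
  shows "(\<lambda>N. integral {a N..b N} u) \<longlonglongrightarrow> c *\<^sub>R (LINT x|lebesgue. u x)"
proof -
  have "(\<lambda>N. LINT x|lebesgue. indicator {a N..b N} x *\<^sub>R u x) \<longlonglongrightarrow> (LINT x|lebesgue. c *\<^sub>R u x)"
  proof (rule integral_dominated_convergence)
    show "integrable lebesgue (\<lambda>x. norm (u x))" using u by (rule integrable_norm)
    show "AE x in lebesgue. (\<lambda>N. indicator {a N..b N} x *\<^sub>R u x) \<longlonglongrightarrow> c *\<^sub>R u x"
    proof (rule always_eventually, rule allI)
      fix x
      show "(\<lambda>N. indicator {a N..b N} x *\<^sub>R u x) \<longlonglongrightarrow> c *\<^sub>R u x"
        by (rule tendsto_eventually) (use ev[of x] in eventually_elim, simp)
    qed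
    show "(\<lambda>x. c *\<^sub>R u x) \<in> borel_measurable lebesgue"
      "(\<lambda>x. indicator {a N..b N} x *\<^sub>R u x) \<in> borel_measurable lebesgue" for N
      using u by (auto intro!: borel_measurable_scaleR borel_measurable_indicator dest: borel_measurable_integrable)
  qed (auto simp: indicator_def)
  then show ?thesis by (simp add: integrable_lebesgue_Icc(3)[OF u])
qed

text \<open>For each \<open>t\<close> in the window, \<open>\<psi> a\<close> differs from
  \<open>\<psi> t\<close> by at most the integral of \<open>cmod (d t)\<close> over the window;
  integrate this over \<open>t\<close>.\<close>

lemma norm_le_mean_plus_variation:
  fixes \<psi> :: "real \<Rightarrow> complex"
  assumes \<psi>: "integrable lebesgue \<psi>" and d: "integrable lebesgue d" and h: "0 < h"
    and ftc: "\<And>a b. a \<le> b \<Longrightarrow> (d has_integral (\<psi> b - \<psi> a)) {a..b}"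
  shows "h * cmod (\<psi> a) \<le> integral {a..a + h} (\<lambda>t. cmod (\<psi> t)) + h * integral {a..a + h} (\<lambda>t. cmod (d t))"
proof -
  define C where "C = integral {a..a + h} (\<lambda>t. cmod (d t))"
  have nd: "integrable lebesgue (\<lambda>t. cmod (d t))" using d by (rule integrable_norm)
  have n\<psi>: "integrable lebesgue (\<lambda>t. cmod (\<psi> t))" using \<psi> by (rule integrable_norm)
  have le: "cmod (\<psi> a) \<le> cmod (\<psi> t) + C" if t: "t \<in> {a..a + h}" for t
  proof -
    have "cmod (\<psi> t - \<psi> a) = cmod (integral {a..t} d)"
      using integral_unique[OF ftc[of a t]] t by simp
    also have "\<dots> \<le> integral {a..t} (\<lambda>t. cmod (d t))"
      by (intro integral_norm_bound_integral integrable_lebesgue_Icc d nd) simp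
    also have "\<dots> \<le> C"
      unfolding C_def using t by (intro integral_subset_le integrable_lebesgue_Icc nd) auto
    finally show ?thesis using norm_triangle_sub[of "\<psi> a" "\<psi> t"] by (simp add: norm_minus_commute)
  qed
  have "integral {a..a + h} (\<lambda>_. cmod (\<psi> a)) \<le> integral {a..a + h} (\<lambda>t. cmod (\<psi> t) + C)"
    by (intro integral_le integrable_add integrable_lebesgue_Icc n\<psi> integrable_const_ivl le)
  also have "\<dots> = integral {a..a + h} (\<lambda>t. cmod (\<psi> t)) + h * C"
    using h by (subst integral_add) (auto intro: integrable_lebesgue_Icc n\<psi>)
  finally show ?thesis using h by (simp add: C_def)
qed

text \<open>The value at \<open>a N\<close> is bounded by integrals of two fixed integrable
  functions over a window of length \<open>h\<close>, and these vanish as the window escapes. This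
  gives the decay of both \<phi> and its derivative, at either end of the line.\<close>

lemma tendsto_zero_at_escaping_points:
  fixes \<psi> :: "real \<Rightarrow> complex"
  assumes \<psi>: "integrable lebesgue \<psi>" and d: "integrable lebesgue d" and h: "0 < h"
    and ftc: "\<And>a b. a \<le> b \<Longrightarrow> (d has_integral (\<psi> b - \<psi> a)) {a..b}"
    and ev: "\<And>x. \<forall>\<^sub>F N in sequentially. x \<notin> {a N..a N + h}"
  shows "(\<lambda>N. \<psi> (a N)) \<longlonglongrightarrow> 0"
proof (rule Lim_null_comparison)
  have ev': "\<forall>\<^sub>F N in sequentially. indicator {a N..a N + h} x = (0::real)" for x
    using ev[of x] by eventually_elim simp
  show "\<forall>\<^sub>F N in sequentially. cmod (\<psi> (a N)) \<le>
      integral {a N..a N + h} (\<lambda>t. cmod (\<psi> t)) / h + integral {a N..a N + h} (\<lambda>t. cmod (d t))"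
  proof (intro always_eventually allI)
    fix N
    show "cmod (\<psi> (a N)) \<le>
        integral {a N..a N + h} (\<lambda>t. cmod (\<psi> t)) / h + integral {a N..a N + h} (\<lambda>t. cmod (d t))"
      using norm_le_mean_plus_variation[OF \<psi> d h ftc, of "a N"] h
      by (simp add: field_simps)
  qed
  have "(\<lambda>N. integral {a N..a N + h} (\<lambda>t. cmod (\<psi> t)) / h + integral {a N..a N + h} (\<lambda>t. cmod (d t)))
      \<longlonglongrightarrow> (0 *\<^sub>R (LINT x|lebesgue. cmod (\<psi> x))) / h + 0 *\<^sub>R (LINT x|lebesgue. cmod (d x))"
    by (intro tendsto_add tendsto_divide tendsto_const tendsto_integral_Icc integrable_norm \<psi> d ev')
      (use h in auto)
  then show "(\<lambda>N. integral {a N..a N + h} (\<lambda>t. cmod (\<psi> t)) / h + integral {a N..a N + h} (\<lambda>t. cmod (d t))) \<longlonglongrightarrow> 0"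
    by simp
qed

section \<open>Summation over all cells\<close>

lemma eventually_gt_mult_real:
  assumes "0 < (h::real)"
  shows "\<forall>\<^sub>F N in sequentially. x < h * real N"
proof -
  have "filterlim (\<lambda>N. h * real N) at_top sequentially"
    by (rule filterlim_tendsto_pos_mult_at_top[OF tendsto_const assms filterlim_real_sequentially])
  then show ?thesis by (simp add: filterlim_at_top_dense)
qed

text \<open>The finite identity, solved for the sum, expresses it through boundary terms that vanish
  and integrals that converge; hence convergence of the sums is a conclusion here.\<close>

lemma quadrature_sum_tendsto:
  fixes \<phi> :: "real \<Rightarrow> complex"
  assumes ac: "locally_absolutely_continuous \<phi>" "locally_absolutely_continuous g"
    and int: "integrable lebesgue \<phi>" "integrable lebesgue g" "integrable lebesgue g'"
    and g: "g = (\<lambda>x. vector_derivative \<phi> (at x))" and g': "g' = (\<lambda>x. vector_derivative g (at x))"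
    and h: "0 < h"
  shows "quadrature_sum h \<phi> \<longlonglongrightarrow>
    (LINT t|lebesgue. \<phi> t) - (LINT t|lebesgue. of_real (peano_kernel h t) * g' t)"
    and "cmod (LINT t|lebesgue. of_real (peano_kernel h t) * g' t) \<le> h\<^sup>2 / 12 * L1_norm g'"
proof -
  let ?k = "\<lambda>t. of_real (peano_kernel h t) * g' t"
  have \<phi>: "(\<phi> has_vector_derivative g x) (at x)" for x
    using locally_absolutely_continuous_C1[OF ac(1)] locally_absolutely_continuous_isCont[OF ac(2)]
    unfolding g by blast
  have bd: "cmod (?k t) \<le> h\<^sup>2 / 12 * cmod (g' t)" for t
    unfolding norm_mult norm_of_real by (intro mult_right_mono abs_peano_kernel_le h) simp
  have dom: "integrable lebesgue (\<lambda>t. h\<^sup>2 / 12 * cmod (g' t))"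
    using int(3) by (intro integrable_mult_right integrable_norm)
  have "peano_kernel h \<in> borel_measurable lebesgue"
    by (rule measurable_completion) simp
  then have "?k \<in> borel_measurable lebesgue"
    using borel_measurable_integrable[OF int(3)] by measurable
  then have k: "integrable lebesgue ?k"
    by (rule Bochner_Integration.integrable_bound[OF dom])
      (intro always_eventually allI order_trans[OF bd], simp)
  have "cmod (LINT t|lebesgue. ?k t) \<le> (LINT t|lebesgue. cmod (?k t))"
    by (rule integral_norm_bound)
  also have "\<dots> \<le> (LINT t|lebesgue. h\<^sup>2 / 12 * cmod (g' t))"
    by (intro integral_mono integrable_norm k dom bd)
  also have "\<dots> = h\<^sup>2 / 12 * L1_norm g'" by (simp add: L1_norm_def)
  finally show "cmod (LINT t|lebesgue. ?k t) \<le> h\<^sup>2 / 12 * L1_norm g'" .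
  define I where "I = (\<lambda>N. {- (h * real N)..h * real N})"
  \<comment> \<open>The symmetric sum has \<open>2 * N + 1\<close> nodes and therefore covers
    \<open>2 * N\<close> cells, starting at index \<open>- N\<close>.\<close>
  have Q: "quadrature_sum h \<phi> N = of_real (h\<^sup>2 / 12) * (g (h * real N) - g (- (h * real N)))
      + of_real (h / 2) * (\<phi> (- (h * real N)) + \<phi> (h * real N)) + integral (I N) \<phi> - integral (I N) ?k" for N
    using integral_unique[OF euler_maclaurin_finite[OF \<phi> ac(2) h, of "- int N" "2 * N"]]
    by (simp add: quadrature_sum_def I_def g' algebra_simps)
  have in_ev: "\<forall>\<^sub>F N in sequentially. indicator {- (h * real N)..h * real N} x = (1::real)" for x
    using eventually_gt_mult_real[OF h, of "\<bar>x\<bar>"]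
    by eventually_elim (auto simp: indicator_def abs_less_iff)
  have right: "\<forall>\<^sub>F N in sequentially. x \<notin> {h * real N..h * real N + h}" for x
    using eventually_gt_mult_real[OF h, of x] by eventually_elim auto
  \<comment> \<open>At the left end the window points inwards, but it still escapes:
    \<open>h * N > h - x\<close> puts \<open>x\<close> to the right of it.\<close>
  have left: "\<forall>\<^sub>F N in sequentially. x \<notin> {- (h * real N)..- (h * real N) + h}" for x
    using eventually_gt_mult_real[OF h, of "h - x"] by eventually_elim auto
  have f1: "(g has_integral (\<phi> b - \<phi> a)) {a..b}" if "a \<le> b" for a b
    using locally_absolutely_continuous_FTC[OF ac(1) that] by (simp add: g)
  have f2: "(g' has_integral (g b - g a)) {a..b}" if "a \<le> b" for a b
    using locally_absolutely_continuous_FTC[OF ac(2) that] by (simp add: g')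
  have "quadrature_sum h \<phi> \<longlonglongrightarrow> of_real (h\<^sup>2 / 12) * (0 - 0) + of_real (h / 2) * (0 + 0)
      + 1 *\<^sub>R (LINT t|lebesgue. \<phi> t) - 1 *\<^sub>R (LINT t|lebesgue. ?k t)"
    unfolding Q[abs_def] I_def
    by (intro tendsto_add tendsto_diff tendsto_mult tendsto_const tendsto_integral_Icc int k in_ev
        tendsto_zero_at_escaping_points[OF int(1,2) h f1] left right
        tendsto_zero_at_escaping_points[OF int(2,3) h f2])
  then show "quadrature_sum h \<phi> \<longlonglongrightarrow> (LINT t|lebesgue. \<phi> t) - (LINT t|lebesgue. ?k t)"
    by simp
qed

theorem proposition1p2:
  fixes f :: "real \<Rightarrow> complex" and \<sigma> h :: real
  assumes "f \<in> sobolev_W1 2 \<inter> bcontfun" and "\<sigma> > 0" and "h = 2 * pi / \<sigma>"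
  shows "quadrature_convergent \<sigma> f \<and>
         cmod (quadrature_remainder \<sigma> f) \<le> h\<^sup>2 / 12 * L1_norm (sobolev_deriv 2 2 f)"
proof -
  \<comment> \<open>This is the choice made inside \<open>sobolev_deriv\<close>, so
    \<open>nth_deriv 2 \<phi>\<close> is by definition the function whose norm appears in the
    bound.\<close>
  define \<phi> where "\<phi> = (SOME \<phi>. sobolev_rep 2 f \<phi>)"
  have "\<exists>\<phi>. sobolev_rep 2 f \<phi>" using assms(1) by (simp add: sobolev_W1_def)
  then have rep: "sobolev_rep 2 f \<phi>" unfolding \<phi>_def by (rule someI_ex)
  have n0: "nth_deriv 0 \<phi> = \<phi>" by (simp add: nth_deriv_def)
  have n1: "nth_deriv 1 \<phi> = (\<lambda>x. vector_derivative \<phi> (at x))" by (simp add: nth_deriv_def)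
  have n2: "nth_deriv 2 \<phi> = (\<lambda>x. vector_derivative (nth_deriv 1 \<phi>) (at x))"
    by (simp add: nth_deriv_def numeral_2_eq_2)
  have "locally_absolutely_continuous (nth_deriv 0 \<phi>)" "nth_deriv 0 \<phi> \<in> L1_space"
    and ac1: "locally_absolutely_continuous (nth_deriv 1 \<phi>)"
    and i1: "nth_deriv 1 \<phi> \<in> L1_space" and i2: "nth_deriv 2 \<phi> \<in> L1_space"
    using rep by (auto simp: sobolev_rep_def)
  then have ac0: "locally_absolutely_continuous \<phi>" and i0: "\<phi> \<in> L1_space" by (simp_all only: n0)
  have "continuous_on UNIV f" using assms(1) by (auto simp: bcontfun_def)
  moreover have "continuous_on UNIV \<phi>"
    using locally_absolutely_continuous_isCont[OF ac0] by (simp add: continuous_at_imp_continuous_on)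
  \<comment> \<open>Almost everywhere equality would say nothing about the samples at the nodes,
    which form a null set; with continuity on both sides it becomes equality.\<close>
  ultimately have f: "f = \<phi>"
    using rep by (intro continuous_AE_eq) (auto simp: sobolev_rep_def)
  have h: "0 < h" using assms by simp
  note lim = quadrature_sum_tendsto[OF ac0 ac1 i0[unfolded L1_space_def mem_Collect_eq]
      i1[unfolded L1_space_def mem_Collect_eq] i2[unfolded L1_space_def mem_Collect_eq] n1 n2 h]
  have "sobolev_deriv 2 2 f = nth_deriv 2 \<phi>" by (simp add: sobolev_deriv_def \<phi>_def)
  moreover have "quadrature_remainder \<sigma> f =
      (LINT t|lebesgue. of_real (peano_kernel h t) * nth_deriv 2 \<phi> t)"
    using limI[OF lim(1)] by (simp add: quadrature_remainder_def f flip: assms(3))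
  moreover have "quadrature_convergent \<sigma> f"
    using lim(1) by (auto simp: quadrature_convergent_def convergent_def f simp flip: assms(3))
  ultimately show ?thesis using lim(2) by simp
qed

end
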